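(* Let $k\ge2$ and let $M_1=(U,\mathcal I_1),\ldots,M_k=(U,\mathcal I_k)$ be loopless matroids on a common finite ground set, given by independence oracles. Given a $(k,q)$-pseudocoloring $R_1,\ldots,R_q$ of $M_1,\ldots,M_k$, one can in polynomial time obtain a $k(k-1)q$-coloring of $M_1,\ldots,M_k$.
   Context: For a matroid $M$ with rank function $r$, a set $S$ and integer $p\ge1$, a $p$-flexible decomposition of $S$ in $M$ is a partition $T_1,\ldots,T_\ell$ of $S$ such that $r(T_j)\ge|T_j|-p+1$ for all $j$ and, for any independent sets $I_j\subseteq T_j$, $\bigcup_jI_j$ is independent; it is required to be efficiently computable. A $(p,q)$-pseudocoloring of $M_1,\ldots,M_k$ is a partition $R_1,\ldots,R_q$ of $U$ such that each $R_c$ admits a (polynomial-time computable) $p$-flexible decomposition in $M_i$ for all $i\in[k]$, $c\in[q]$. A $q'$-coloring of $M_1,\ldots,M_k$ is a collection of $q'$ sets in $\bigcap_i\mathcal I_i$ whose union is $U$. *)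

theory Defs
  imports "HOL-Computational_Algebra.Polynomial"
begin

section \<open>Matroids\<close>

locale matroid =
  fixes U :: "'a set" and I :: "'a set set"
  assumes finite_ground: "finite U"
    and indep_subset_ground: "X \<in> I \<Longrightarrow> X \<subseteq> U"
    and empty_indep: "{} \<in> I"
    and indep_subset: "X \<in> I \<Longrightarrow> Y \<subseteq> X \<Longrightarrow> Y \<in> I"
    and augment: "X \<in> I \<Longrightarrow> Y \<in> I \<Longrightarrow> card X < card Y \<Longrightarrow> \<exists>y \<in> Y - X. insert y X \<in> I"

definition loopless :: "'a set \<Rightarrow> 'a set set \<Rightarrow> bool" where
  "loopless U I \<longleftrightarrow> (\<forall>x \<in> U. {x} \<in> I)"

definition rank_of :: "'a set set \<Rightarrow> 'a set \<Rightarrow> nat" where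
  "rank_of I S = Max {card X | X. X \<in> I \<and> X \<subseteq> S}"

text \<open>Blocks of a partition are listed in order and may be empty.\<close>

definition partitions :: "'a set list \<Rightarrow> 'a set \<Rightarrow> bool" where
  "partitions Ts S \<longleftrightarrow> \<Union>(set Ts) = S \<and>
     (\<forall>i < length Ts. \<forall>j < length Ts. i \<noteq> j \<longrightarrow> Ts ! i \<inter> Ts ! j = {})"

text \<open>The first inequality is \<open>r(T) \<ge> |T| - p + 1\<close>, rearranged to avoid truncated subtraction.\<close>

definition flexible_decomposition :: "nat \<Rightarrow> 'a set set \<Rightarrow> 'a set \<Rightarrow> 'a set list \<Rightarrow> bool" where
  "flexible_decomposition p I S Ts \<longleftrightarrow>
     partitions Ts S \<and>
     (\<forall>j < length Ts. rank_of I (Ts ! j) + p \<ge> card (Ts ! j) + 1) \<and>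
     (\<forall>J. (\<forall>j < length Ts. J j \<in> I \<and> J j \<subseteq> Ts ! j) \<longrightarrow> (\<Union>j < length Ts. J j) \<in> I)"

text \<open>A family \<open>M\<^sub>1, \<dots>, M\<^sub>k\<close> of matroids on a common ground set \<open>U\<close> is given by the list \<open>Is\<close> of its
  families of independent sets, so \<open>k = length Is\<close> and indices are shifted to start at 0.
  The requirement that the decompositions be computable in polynomial time is a property of
  classes of pseudocolorings; see \<open>decomposition_problem\<close> below.\<close>

definition pseudocoloring ::
    "nat \<Rightarrow> nat \<Rightarrow> 'a set \<Rightarrow> 'a set set list \<Rightarrow> 'a set list \<Rightarrow> bool" where
  "pseudocoloring p q U Is R \<longleftrightarrow>
     length R = q \<and> partitions R U \<and>
     (\<forall>c < q. \<forall>i < length Is. \<exists>Ts. flexible_decomposition p (Is ! i) (R ! c) Ts)"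

definition coloring :: "nat \<Rightarrow> 'a set \<Rightarrow> 'a set set list \<Rightarrow> 'a set list \<Rightarrow> bool" where
  "coloring q U Is Q \<longleftrightarrow>
     length Q = q \<and> (\<forall>X \<in> set Q. \<forall>I \<in> set Is. X \<in> I) \<and> \<Union>(set Q) = U"

section \<open>Polynomial-time computation with access to a black box\<close>

text \<open>Programs are those of the WHILE language on binary trees (N. D. Jones, Computability and
  Complexity from a Programming Perspective), whose polynomial-time computable functions, with unit
  cost per instruction, are those of Turing machines. The leaves are \<open>DNil\<close>, also used
  for falsity, and names of ground set elements, which programs can only test for equality.
  There are two additions: \<open>Query\<close> asks the black box a question and pays for the size of the
  question; \<open>Call\<close> runs a program on an argument in a store of its own and pays for that run
  (there is no recursion, so this is only a form of inlining).\<close>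

datatype 'a data = DNil | DAtom 'a | DPair "'a data" "'a data"

type_synonym 'a store = "nat \<Rightarrow> 'a data"

datatype expr = Var nat | ENil | EPair expr expr | Fst expr | Snd expr | EqAtom expr expr

datatype com =
    Assign nat expr
  | Seq com com
  | If expr com com
  | While expr com
  | Query nat expr
  | Call nat com expr

primrec dsize :: "'a data \<Rightarrow> nat" where
  "dsize DNil = 1"
| "dsize (DAtom a) = 1"
| "dsize (DPair x y) = 1 + dsize x + dsize y"

definition dbool :: "bool \<Rightarrow> 'a data" where
  "dbool b = (if b then DPair DNil DNil else DNil)"

primrec evalE :: "expr \<Rightarrow> 'a store \<Rightarrow> 'a data" where
  "evalE (Var x) s = s x"
| "evalE ENil s = DNil"
| "evalE (EPair e f) s = DPair (evalE e s) (evalE f s)"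
| "evalE (Fst e) s = (case evalE e s of DPair x y \<Rightarrow> x | _ \<Rightarrow> DNil)"
| "evalE (Snd e) s = (case evalE e s of DPair x y \<Rightarrow> y | _ \<Rightarrow> DNil)"
| "evalE (EqAtom e f) s = dbool (\<exists>a. evalE e s = DAtom a \<and> evalE f s = DAtom a)"

definition input_store :: "'a data \<Rightarrow> 'a store" where
  "input_store d = (\<lambda>_. DNil)(0 := d)"

text \<open>\<open>exec ask c s t s'\<close>: with black box \<open>ask\<close>, program \<open>c\<close> started in store \<open>s\<close> terminates after
  \<open>t\<close> time units in store \<open>s'\<close>. Evaluating an expression costs one unit, since its number of
  operations is a constant of the program.\<close>

inductive exec :: "('a data \<Rightarrow> bool) \<Rightarrow> com \<Rightarrow> 'a store \<Rightarrow> nat \<Rightarrow> 'a store \<Rightarrow> bool"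
  for ask :: "'a data \<Rightarrow> bool" where
  Assign: "exec ask (Assign x e) s 1 (s(x := evalE e s))"
| Seq: "exec ask c s t s' \<Longrightarrow> exec ask d s' t' s'' \<Longrightarrow> exec ask (Seq c d) s (t + t') s''"
| IfTrue: "evalE e s \<noteq> DNil \<Longrightarrow> exec ask c s t s' \<Longrightarrow> exec ask (If e c d) s (1 + t) s'"
| IfFalse: "evalE e s = DNil \<Longrightarrow> exec ask d s t s' \<Longrightarrow> exec ask (If e c d) s (1 + t) s'"
| WhileFalse: "evalE e s = DNil \<Longrightarrow> exec ask (While e c) s 1 s"
| WhileTrue: "evalE e s \<noteq> DNil \<Longrightarrow> exec ask c s t s' \<Longrightarrow> exec ask (While e c) s' t' s'' \<Longrightarrow>
    exec ask (While e c) s (1 + t + t') s''"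
| Query: "exec ask (Query x e) s (1 + dsize (evalE e s)) (s(x := dbool (ask (evalE e s))))"
| Call: "exec ask c (input_store (evalE e s)) t s' \<Longrightarrow>
    exec ask (Call x c e) s (1 + t) (s(x := s' 0))"

lemma exec_deterministic:
  "exec ask c s t s1 \<Longrightarrow> exec ask c s t' s2 \<Longrightarrow> t = t' \<and> s1 = s2"
proof (induction arbitrary: t' s2 rule: exec.induct)
  case (Assign x e s)
  then show ?case by (auto elim: exec.cases)
next
  case (Seq c s t s' d u s'')
  from Seq.prems show ?case
    by (cases rule: exec.cases) (use Seq.IH in blast)+
next
  case (IfTrue e s c t s' d)
  from IfTrue.prems show ?case
    by (cases rule: exec.cases) (use IfTrue.IH IfTrue.hyps in blast)+
next
  case (IfFalse e s d t s' c)
  from IfFalse.prems show ?case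
    by (cases rule: exec.cases) (use IfFalse.IH IfFalse.hyps in blast)+
next
  case (WhileFalse e s c)
  from WhileFalse.prems show ?case
    by (cases rule: exec.cases) (use WhileFalse.hyps in blast)+
next
  case (WhileTrue e s c t s' u s'')
  from WhileTrue.prems show ?case
    by (cases rule: exec.cases) (use WhileTrue.IH WhileTrue.hyps in blast)+
next
  case (Query x e s)
  then show ?case by (auto elim: exec.cases)
next
  case (Call c e s t s' x)
  from Call.prems show ?case
    by (cases rule: exec.cases) (use Call.IH in blast)+
qed

text \<open>A computational problem is a set of triples of a black box, an input and the
  set of admissible outputs. One program and one polynomial must serve all of them.\<close>

definition polytime_solvable ::
    "(('a data \<Rightarrow> bool) \<times> 'a data \<times> 'a data set) set \<Rightarrow> bool" where
  "polytime_solvable P \<longleftrightarrow>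
     (\<exists>(c :: com) (p :: nat poly). \<forall>(ask, d, good) \<in> P.
        \<exists>t s. exec ask c (input_store d) t s \<and> t \<le> poly p (dsize d) \<and> s 0 \<in> good)"

section \<open>Encodings\<close>

primrec dlist :: "'a data list \<Rightarrow> 'a data" where
  "dlist [] = DNil"
| "dlist (x # xs) = DPair x (dlist xs)"

text \<open>Numbers are in unary. A set is represented by any list of its elements.\<close>

definition dnat :: "nat \<Rightarrow> 'a data" where
  "dnat n = dlist (replicate n DNil)"

definition encodes_set :: "'a data \<Rightarrow> 'a set \<Rightarrow> bool" where
  "encodes_set d X \<longleftrightarrow> (\<exists>xs. d = dlist (map DAtom xs) \<and> set xs = X)"

definition encodes_sets :: "'a data \<Rightarrow> 'a set list \<Rightarrow> bool" where
  "encodes_sets d Xs \<longleftrightarrow> (\<exists>ds. d = dlist ds \<and> list_all2 encodes_set ds Xs)"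

definition encodes_instance ::
    "'a data \<Rightarrow> 'a set \<Rightarrow> 'a set set list \<Rightarrow> 'a set list \<Rightarrow> bool" where
  "encodes_instance d U Is R \<longleftrightarrow>
     (\<exists>u r. d = DPair (dnat (length Is)) (DPair u r) \<and> encodes_set u U \<and> encodes_sets r R)"

text \<open>The matroids themselves are not part of the input: programs can only ask whether
  a given set is independent in the \<open>i\<close>-th matroid.\<close>

definition indep_query :: "'a set set list \<Rightarrow> 'a data \<Rightarrow> bool" where
  "indep_query Is d \<longleftrightarrow>
     (\<exists>i x X. d = DPair (dnat i) x \<and> encodes_set x X \<and> i < length Is \<and> X \<in> Is ! i)"

section \<open>The two computational problems\<close>

text \<open>Given an instance (matroids and a pseudocoloring \<open>R\<close>) and indices \<open>i\<close>, \<open>c\<close>, find a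
  \<open>p\<close>-flexible decomposition of \<open>R\<^sub>c\<close> in \<open>M\<^sub>i\<close>; \<open>p\<close> may depend on the number of matroids.\<close>

definition decomposition_problem ::
    "(nat \<Rightarrow> nat) \<Rightarrow> ('a set \<times> 'a set set list \<times> 'a set list) set \<Rightarrow>
      (('a data \<Rightarrow> bool) \<times> 'a data \<times> 'a data set) set" where
  "decomposition_problem p \<C> =
     {(indep_query Is, DPair d (DPair (dnat i) (dnat c)),
        {out. \<exists>Ts. encodes_sets out Ts \<and>
                    flexible_decomposition (p (length Is)) (Is ! i) (R ! c) Ts})
      | U Is R d i c. (U, Is, R) \<in> \<C> \<and> encodes_instance d U Is R \<and>
                      i < length Is \<and> c < length R}"

text \<open>Given an instance with \<open>k\<close> matroids and \<open>q\<close> classes, find an \<open>m k q\<close>-coloring.\<close>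

definition coloring_problem ::
    "(nat \<Rightarrow> nat \<Rightarrow> nat) \<Rightarrow> ('a set \<times> 'a set set list \<times> 'a set list) set \<Rightarrow>
      (('a data \<Rightarrow> bool) \<times> 'a data \<times> 'a data set) set" where
  "coloring_problem m \<C> =
     {(indep_query Is, d,
        {out. \<exists>Q. encodes_sets out Q \<and> coloring (m (length Is) (length R)) U Is Q})
      | U Is R d. (U, Is, R) \<in> \<C> \<and> encodes_instance d U Is R}"

end

(* In a block T of a decomposition for one matroid, pick a basis B. The set E = T - B has at most
   k - 1 elements, and every e in E has a partner b in B such that B - b + e is independent. Join
   all pairs in E and join every element of E to its partner: degrees are at most k - 1, and a set
   without edges in T is independent. Doing this for all blocks and all matroids gives a graph on
   the class R_c of maximum degree at most D = k (k - 1) whose stable sets are common independent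
   sets, so that D + 1 colors suffice greedily.

   To save one color, follow Brooks. Insert the vertices one by one; if the new vertex x is stuck, its
   D neighbors have D distinct colors, and we can pass the state of being uncolored to any of them
   (a token). If the token is stuck wherever it goes, then x and its neighbors have full degree,
   which forces the edges of each matroid to form k-cliques around x. For k >= 3, x lies in a triangle
   x, y, y' and has a neighbor z that is not adjacent to y, and some walk along a Kempe chain gets
   the token unstuck; for k = 2, the Kempe chain closes up to an odd cycle in a union of two
   matchings. All walks that the argument needs follow one of polynomially many color patterns,
   so they can all be tried. *)
theory Submission
  imports Defs
begin

section \<open>Closure properties of polynomial time\<close>

text \<open>The number \<open>k (k - 1)\<close> leaves no slack: a vertex with \<open>D\<close>
  neighbors has exactly \<open>k - 1\<close> of them in each of the \<open>k\<close> graphs, and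
  none is shared. In a block, a basis element has degree \<open>k - 1\<close> only if it is the
  partner of every element of \<open>E\<close>, so any two vertices of full degree in a block are
  adjacent; this is where the cliques come from. They play the part of the hypothesis in Brooks'
  theorem that excludes complete graphs: if \<open>y\<close> were adjacent to all
  \<open>k - 1\<close> neighbors of \<open>x\<close> in a graph other than that of the edge
  \<open>x y\<close>, these \<open>k - 1\<close> edges would need distinct matroids among the
  \<open>k - 2\<close> remaining ones. The program is oblivious to all this. It tries
  \<open>D^4\<close> walks, given by four colors each, and the argument only has to show that they
  do not all fail. Another obstacle is the cost model. Since expressions have unit cost, a fast
  program can build values of exponential size, so size bounds accompany the time bounds. For the
  given decomposition program only the running time is known; there the depth of its output is
  bounded first.\<close>

lemma poly_nat_mono: "m \<le> n \<Longrightarrow> poly p m \<le> poly p n" for p :: "nat poly"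
  by (induction p) (auto intro: add_mono mult_mono)

text \<open>The bound on the size of the output is needed for closure under composition: since expressions
  have unit cost, a polynomial-time program can build values of exponential size.\<close>

definition polytime ::
    "(('a data \<Rightarrow> bool) \<times> 'x) set \<Rightarrow> ('x \<Rightarrow> 'a data) \<Rightarrow> ('y \<Rightarrow> 'a data) \<Rightarrow>
      (('a data \<Rightarrow> bool) \<Rightarrow> 'x \<Rightarrow> 'y) \<Rightarrow> bool" where
  "polytime A E F f \<longleftrightarrow>
     (\<exists>(c :: com) (p :: nat poly). \<forall>(ask, x) \<in> A.
        (\<exists>t s. exec ask c (input_store (E x)) t s \<and> t \<le> poly p (dsize (E x)) \<and>
               s 0 = F (f ask x)) \<and>
        dsize (F (f ask x)) \<le> poly p (dsize (E x)))"

lemma polytimeI: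
  fixes p q :: "nat poly"
  assumes "\<And>ask x. (ask, x) \<in> A \<Longrightarrow>
      \<exists>t s. exec ask c (input_store (E x)) t s \<and> t \<le> poly p (dsize (E x)) \<and> s 0 = F (f ask x)"
    and "\<And>ask x. (ask, x) \<in> A \<Longrightarrow> dsize (F (f ask x)) \<le> poly q (dsize (E x))"
  shows "polytime A E F f"
  unfolding polytime_def
proof (intro exI ballI, clarify, intro conjI)
  fix ask x assume A: "(ask, x) \<in> A"
  show "\<exists>t s. exec ask c (input_store (E x)) t s \<and> t \<le> poly (p + q) (dsize (E x)) \<and> s 0 = F (f ask x)"
    using assms(1)[OF A] by (auto intro: trans_le_add1)
  show "dsize (F (f ask x)) \<le> poly (p + q) (dsize (E x))"
    using assms(2)[OF A] by simp
qed

lemma polytimeE: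
  assumes "polytime A E F f"
  obtains c and p :: "nat poly"
  where "\<And>ask x. (ask, x) \<in> A \<Longrightarrow>
      \<exists>t s. exec ask c (input_store (E x)) t s \<and> t \<le> poly p (dsize (E x)) \<and> s 0 = F (f ask x)"
    and "\<And>ask x. (ask, x) \<in> A \<Longrightarrow> dsize (F (f ask x)) \<le> poly p (dsize (E x))"
  using assms unfolding polytime_def by blast

lemma polytime_cong:
  assumes "polytime A E F f" and "\<And>ask x. (ask, x) \<in> A \<Longrightarrow> F (f ask x) = G (g ask x)"
  shows "polytime A E G g"
proof (rule polytimeE[OF assms(1)])
  fix c and p :: "nat poly"
  assume "\<And>ask x. (ask, x) \<in> A \<Longrightarrow>
      \<exists>t s. exec ask c (input_store (E x)) t s \<and> t \<le> poly p (dsize (E x)) \<and> s 0 = F (f ask x)"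
    and "\<And>ask x. (ask, x) \<in> A \<Longrightarrow> dsize (F (f ask x)) \<le> poly p (dsize (E x))"
  then show ?thesis
    by (intro polytimeI[of A c E p G g p]) (simp_all only: assms(2))
qed

lemma exec_CallI:
  assumes "exec ask c (input_store d) t s'" and "evalE e s = d" and "s' 0 = v"
  shows "exec ask (Call x c e) s (1 + t) (s(x := v))"
  using exec.Call[of ask c e s t s' x] assms by simp

lemma exec_witness:
  "exec ask c s t s' \<Longrightarrow> t \<le> b \<Longrightarrow> P s' \<Longrightarrow> \<exists>t s'. exec ask c s t s' \<and> t \<le> b \<and> P s'"
  by blast

lemma input_store_0 [simp]: "input_store d 0 = d"
  by (simp add: input_store_def)

text \<open>The second program starts from an intermediate value whose size, by the output bound, is
  polynomial in the size of the input; its time is then bounded by the composed polynomial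
  \<open>pcompose q p\<close>.\<close>

lemma polytime_comp:
  assumes "polytime A E F f" and "polytime B F G g"
    and "\<And>ask x. (ask, x) \<in> A \<Longrightarrow> (ask, f ask x) \<in> B"
  shows "polytime A E G (\<lambda>ask x. g ask (f ask x))"
proof -
  obtain c p where c: "\<And>ask x. (ask, x) \<in> A \<Longrightarrow>
      \<exists>t s. exec ask c (input_store (E x)) t s \<and> t \<le> poly p (dsize (E x)) \<and> s 0 = F (f ask x)"
    and p: "\<And>ask x. (ask, x) \<in> A \<Longrightarrow> dsize (F (f ask x)) \<le> poly p (dsize (E x))"
    using polytimeE[OF assms(1)] by metis
  obtain d q where d: "\<And>ask x. (ask, x) \<in> B \<Longrightarrow>
      \<exists>t s. exec ask d (input_store (F x)) t s \<and> t \<le> poly q (dsize (F x)) \<and> s 0 = G (g ask x)"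
    and q: "\<And>ask x. (ask, x) \<in> B \<Longrightarrow> dsize (G (g ask x)) \<le> poly q (dsize (F x))"
    using polytimeE[OF assms(2)] by metis
  have q': "poly q (dsize (F (f ask x))) \<le> poly (pcompose q p) (dsize (E x))"
    if "(ask, x) \<in> A" for ask x
    using poly_nat_mono[OF p[OF that]] by (simp add: poly_pcompose)
  show ?thesis
  proof (rule polytimeI[where c = "Seq (Call 0 c (Var 0)) (Call 0 d (Var 0))"
        and p = "[:2:] + p + pcompose q p" and q = "pcompose q p"])
    fix ask x assume A: "(ask, x) \<in> A"
    obtain t s where 1: "exec ask c (input_store (E x)) t s" "t \<le> poly p (dsize (E x))"
      "s 0 = F (f ask x)" using c[OF A] by blast
    obtain t' s' where 2: "exec ask d (input_store (F (f ask x))) t' s'"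
      "t' \<le> poly q (dsize (F (f ask x)))" "s' 0 = G (g ask (f ask x))" using d[OF assms(3)[OF A]] by blast
    have "exec ask (Seq (Call 0 c (Var 0)) (Call 0 d (Var 0))) (input_store (E x))
       ((1 + t) + (1 + t')) ((input_store (E x))(0 := s 0, 0 := s' 0))"
      by (rule exec.Seq[OF exec_CallI[OF 1(1)] exec_CallI[OF 2(1)]]) (simp_all add: 1(3))
    moreover have "(1 + t) + (1 + t') \<le> poly ([:2:] + p + pcompose q p) (dsize (E x))"
      using 1 2 q'[OF A] by simp
    ultimately show "\<exists>t s. exec ask (Seq (Call 0 c (Var 0)) (Call 0 d (Var 0))) (input_store (E x)) t s \<and>
       t \<le> poly ([:2:] + p + pcompose q p) (dsize (E x)) \<and> s 0 = G (g ask (f ask x))"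
      by (rule exec_witness) (use 2 in auto)
  next
    fix ask x assume A: "(ask, x) \<in> A"
    show "dsize (G (g ask (f ask x))) \<le> poly (pcompose q p) (dsize (E x))"
      using q[OF assms(3)[OF A]] q'[OF A] by simp
  qed
qed

section \<open>Encoders and the size of encoded data\<close>

definition eprod :: "('x \<Rightarrow> 'a data) \<Rightarrow> ('y \<Rightarrow> 'a data) \<Rightarrow> 'x \<times> 'y \<Rightarrow> 'a data" where
  "eprod E F p = DPair (E (fst p)) (F (snd p))"

definition elist :: "('x \<Rightarrow> 'a data) \<Rightarrow> 'x list \<Rightarrow> 'a data" where
  "elist E xs = dlist (map E xs)"

text \<open>Lists of units and unary numbers have the same encoding. Loops that run \<open>n\<close>
  times thus become folds over \<open>replicate n ()\<close>, and a length is found by mapping all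
  entries to \<open>()\<close>.\<close>

definition eunit :: "unit \<Rightarrow> 'a data" where
  "eunit u = DNil"

lemma eprod_pair [simp]: "eprod E F (x, y) = DPair (E x) (F y)"
  by (simp add: eprod_def)

lemma elist_simps [simp]: "elist E [] = DNil" "elist E (x # xs) = DPair (E x) (elist E xs)"
  by (simp_all add: elist_def)

lemma elist_eq_DNil [simp]: "elist E xs = DNil \<longleftrightarrow> xs = []"
  by (cases xs) auto

lemma dnat_simps [simp]: "dnat 0 = DNil" "dnat (Suc n) = DPair DNil (dnat n)"
  by (simp_all add: dnat_def)

lemma dnat_eq_DNil [simp]: "dnat n = DNil \<longleftrightarrow> n = 0"
  by (cases n) auto

lemma dbool_eq_DNil [simp]: "dbool b = DNil \<longleftrightarrow> \<not> b"
  by (simp add: dbool_def)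

lemma dsize_dnat: "dsize (dnat n) = 2 * n + 1"
  by (induction n) auto

lemma dsize_dbool: "dsize (dbool b) \<le> 3"
  by (simp add: dbool_def)

lemma dsize_elist: "dsize (elist E xs) = 1 + length xs + (\<Sum>x\<leftarrow>xs. dsize (E x))"
  by (induction xs) auto

lemma dsize_pos: "dsize d > 0"
  by (cases d) auto

lemma length_le_dsize_elist: "length xs \<le> dsize (elist E xs)"
  by (simp add: dsize_elist)

lemma dsize_elist_member: "x \<in> set xs \<Longrightarrow> dsize (E x) \<le> dsize (elist E xs)"
  by (induction xs) auto

lemma dsize_elist_le:
  assumes "\<And>x. x \<in> set xs \<Longrightarrow> dsize (E x) \<le> m"
  shows "dsize (elist E xs) \<le> 1 + length xs * (1 + m)"
  using assms
proof (induction xs)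
  case (Cons a xs)
  have "dsize (E a) \<le> m" "dsize (elist E xs) \<le> 1 + length xs * (1 + m)"
    using Cons by auto
  then show ?case by simp
qed simp

section \<open>Programs for single operations, case distinctions and loops\<close>

lemma polytime_id: "polytime A E E (\<lambda>ask x. x)"
proof (rule polytimeI[where c = "Assign 0 (Var 0)" and p = "[:1:]" and q = "[:0, 1:]"])
  fix ask x
  show "\<exists>t s. exec ask (Assign 0 (Var 0)) (input_store (E x)) t s \<and> t \<le> poly [:1:] (dsize (E x)) \<and> s 0 = E x"
    by (intro exI conjI, rule exec.Assign) auto
qed simp

lemma polytime_expr:
  assumes "polytime A E F f"
    and "\<And>ask x. (ask, x) \<in> A \<Longrightarrow> evalE e (input_store (F (f ask x))) = G (g ask x)"
    and "\<And>ask x. (ask, x) \<in> A \<Longrightarrow> dsize (G (g ask x)) \<le> dsize (F (f ask x)) + m"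
  shows "polytime A E G g"
proof -
  have 1: "polytime A E id (\<lambda>ask x. F (f ask x))"
    using assms(1) unfolding polytime_def by simp
  \<comment> \<open>With \<open>id\<close> as encoder the expression runs on the raw value. The
    domain consists of the values that occur, since the size bound is assumed for these
    alone.\<close>
  have "polytime {(ask, F (f ask x)) |ask x. (ask, x) \<in> A} id id (\<lambda>ask d. evalE e (input_store d))"
  proof (rule polytimeI[where c = "Assign 0 e" and p = "[:1:]" and q = "[:m, 1:]"], goal_cases)
    case (1 ask x)
    show ?case by (intro exI conjI, rule exec.Assign) auto
  next
    case (2 ask x)
    then show ?case using assms(2,3) by (auto simp: add.commute)
  qed
  from polytime_comp[OF 1 this]
  have 2: "polytime A E id (\<lambda>ask x. evalE e (input_store (F (f ask x))))" by blast
  show ?thesis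
    by (rule polytime_cong[OF 2]) (simp add: assms(2))
qed

lemma polytime_Pair:
  assumes "polytime A E F f" and "polytime A E G g"
  shows "polytime A E (eprod F G) (\<lambda>ask x. (f ask x, g ask x))"
proof -
  obtain c p where c: "\<And>ask x. (ask, x) \<in> A \<Longrightarrow>
      \<exists>t s. exec ask c (input_store (E x)) t s \<and> t \<le> poly p (dsize (E x)) \<and> s 0 = F (f ask x)"
    and p: "\<And>ask x. (ask, x) \<in> A \<Longrightarrow> dsize (F (f ask x)) \<le> poly p (dsize (E x))"
    using polytimeE[OF assms(1)] by metis
  obtain d q where d: "\<And>ask x. (ask, x) \<in> A \<Longrightarrow>
      \<exists>t s. exec ask d (input_store (E x)) t s \<and> t \<le> poly q (dsize (E x)) \<and> s 0 = G (g ask x)"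
    and q: "\<And>ask x. (ask, x) \<in> A \<Longrightarrow> dsize (G (g ask x)) \<le> poly q (dsize (E x))"
    using polytimeE[OF assms(2)] by metis
  let ?c = "Seq (Call 1 c (Var 0)) (Seq (Call 2 d (Var 0)) (Assign 0 (EPair (Var 1) (Var 2))))"
  show ?thesis
  proof (rule polytimeI[where c = ?c and p = "[:3:] + p + q" and q = "[:1:] + p + q"])
    fix ask x assume A: "(ask, x) \<in> A"
    obtain t s where 1: "exec ask c (input_store (E x)) t s" "t \<le> poly p (dsize (E x))"
      "s 0 = F (f ask x)" using c[OF A] by blast
    obtain t' s' where 2: "exec ask d (input_store (E x)) t' s'"
      "t' \<le> poly q (dsize (E x))" "s' 0 = G (g ask x)" using d[OF A] by blast
    let ?s = "(input_store (E x))(1 := s 0, 2 := s' 0)"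
    have "exec ask ?c (input_store (E x)) ((1 + t) + ((1 + t') + 1))
        (?s(0 := evalE (EPair (Var 1) (Var 2)) ?s))"
      by (rule exec.Seq[OF exec_CallI[OF 1(1)] exec.Seq[OF exec_CallI[OF 2(1)] exec.Assign]])
        simp_all
    moreover have "(1 + t) + ((1 + t') + 1) \<le> poly ([:3:] + p + q) (dsize (E x))"
      using 1 2 by simp
    ultimately show "\<exists>t s. exec ask ?c (input_store (E x)) t s \<and>
       t \<le> poly ([:3:] + p + q) (dsize (E x)) \<and> s 0 = eprod F G (f ask x, g ask x)"
      by (rule exec_witness) (use 1 2 in auto)
  next
    fix ask x assume A: "(ask, x) \<in> A"
    show "dsize (eprod F G (f ask x, g ask x)) \<le> poly ([:1:] + p + q) (dsize (E x))"
      using p[OF A] q[OF A] by simp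
  qed
qed

lemma polytime_fst:
  assumes "polytime A E (eprod F G) f"
  shows "polytime A E F (\<lambda>ask x. fst (f ask x))"
  by (rule polytime_expr[OF assms, where e = "Fst (Var 0)" and m = 0]) (auto simp: eprod_def)

lemma polytime_snd:
  assumes "polytime A E (eprod F G) f"
  shows "polytime A E G (\<lambda>ask x. snd (f ask x))"
  by (rule polytime_expr[OF assms, where e = "Snd (Var 0)" and m = 0]) (auto simp: eprod_def)

lemma polytime_Nil: "polytime A E (elist F) (\<lambda>ask x. [])"
  by (rule polytime_expr[OF polytime_id, where e = ENil and m = 1]) auto

lemma polytime_Cons:
  assumes "polytime A E F f" and "polytime A E (elist F) g"
  shows "polytime A E (elist F) (\<lambda>ask x. f ask x # g ask x)"
  by (rule polytime_expr[OF polytime_Pair[OF assms], where e = "Var 0" and m = 0]) auto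

text \<open>\<open>Snd\<close> drops one unit of a unary number and maps \<open>DNil\<close> to
  itself, in accordance with truncated subtraction.\<close>

lemma polytime_pred:
  assumes "polytime A E dnat f"
  shows "polytime A E dnat (\<lambda>ask x. f ask x - 1)"
proof (rule polytime_expr[OF assms, where e = "Snd (Var 0)" and m = 0], goal_cases)
  case (1 ask x)
  then show ?case by (cases "f ask x") auto
qed (simp add: dsize_dnat)

lemma polytime_replicate_unit:
  fixes E :: "'x \<Rightarrow> 'a data"
  assumes "polytime A E dnat f"
  shows "polytime A E (elist eunit) (\<lambda>ask x. replicate (f ask x) ())"
proof (rule polytime_expr[OF assms, where e = "Var 0" and m = 0])
  have "elist eunit (replicate n ()) = (dnat n :: 'a data)" for n
    by (induction n) (auto simp: eunit_def)
  then show "evalE (Var 0) (input_store (dnat (f ask x))) = (elist eunit (replicate (f ask x) ()) :: 'a data)"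
    "dsize (elist eunit (replicate (f ask x) ()) :: 'a data) \<le> dsize (dnat (f ask x) :: 'a data) + 0" for ask x
    by simp_all
qed

lemma polytime_length_unit:
  fixes E :: "'x \<Rightarrow> 'a data"
  assumes "polytime A E (elist eunit) f"
  shows "polytime A E dnat (\<lambda>ask x. length (f ask x))"
proof -
  have "elist eunit xs = (dnat (length xs) :: 'a data)" for xs :: "unit list"
    by (induction xs) (auto simp: eunit_def)
  then show ?thesis
    by (intro polytime_expr[OF assms, where e = "Var 0" and m = 0]) simp_all
qed


lemma polytime_eq_atom:
  assumes "polytime A E DAtom f" and "polytime A E DAtom g"
  shows "polytime A E dbool (\<lambda>ask x. f ask x = g ask x)"
  by (rule polytime_expr[OF polytime_Pair[OF assms], where e = "EqAtom (Fst (Var 0)) (Snd (Var 0))" and m = 3])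
    (simp_all add: dbool_def)

lemma polytime_ask:
  assumes "polytime A E F f"
  shows "polytime A E dbool (\<lambda>ask x. ask (F (f ask x)))"
proof -
  have "polytime UNIV F dbool (\<lambda>ask d. ask (F d))"
  proof (rule polytimeI[where c = "Query 0 (Var 0)" and p = "[:1, 1:]" and q = "[:3:]"], goal_cases)
    case (1 ask x)
    show ?case by (intro exI conjI, rule exec.Query) auto
  qed (simp add: dsize_dbool)
  from polytime_comp[OF assms this] show ?thesis by simp
qed

lemma polytime_case_list:
  assumes "polytime A E (elist F) l" and "polytime A E G a"
    and "polytime {(ask, (y, x)). (ask, x) \<in> A \<and> y \<in> set (l ask x)} (eprod F E) G
          (\<lambda>ask p. h ask (fst p) (snd p))"
  shows "polytime A E G (\<lambda>ask x. case l ask x of [] \<Rightarrow> a ask x | y # ys \<Rightarrow> h ask y x)"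
proof -
  obtain cl pl where cl: "\<And>ask x. (ask, x) \<in> A \<Longrightarrow>
      \<exists>t s. exec ask cl (input_store (E x)) t s \<and> t \<le> poly pl (dsize (E x)) \<and> s 0 = elist F (l ask x)"
    and pl: "\<And>ask x. (ask, x) \<in> A \<Longrightarrow> dsize (elist F (l ask x)) \<le> poly pl (dsize (E x))"
    using polytimeE[OF assms(1)] by metis
  obtain ca pa where ca: "\<And>ask x. (ask, x) \<in> A \<Longrightarrow>
      \<exists>t s. exec ask ca (input_store (E x)) t s \<and> t \<le> poly pa (dsize (E x)) \<and> s 0 = G (a ask x)"
    and pa: "\<And>ask x. (ask, x) \<in> A \<Longrightarrow> dsize (G (a ask x)) \<le> poly pa (dsize (E x))"
    using polytimeE[OF assms(2)] by metis
  obtain ch ph where ch: "\<And>ask y x. (ask, x) \<in> A \<Longrightarrow> y \<in> set (l ask x) \<Longrightarrow>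
      \<exists>t s. exec ask ch (input_store (DPair (F y) (E x))) t s \<and>
        t \<le> poly ph (1 + dsize (F y) + dsize (E x)) \<and> s 0 = G (h ask y x)"
    and ph: "\<And>ask y x. (ask, x) \<in> A \<Longrightarrow> y \<in> set (l ask x) \<Longrightarrow>
        dsize (G (h ask y x)) \<le> poly ph (1 + dsize (F y) + dsize (E x))"
    apply (rule polytimeE[OF assms(3)])
    subgoal premises prems for c p
      apply (rule prems(1)[of c p])
      subgoal for ask y x
        using prems(2)[of ask "(y, x)"] by simp
      subgoal for ask y x
        using prems(3)[of ask "(y, x)"] by simp
      done
    done
  let ?c = "Seq (Call 1 cl (Var 0)) (If (Var 1) (Call 0 ch (EPair (Fst (Var 1)) (Var 0))) (Call 0 ca (Var 0)))"
  let ?q = "pcompose ph ([:1, 1:] + pl)"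
  have q: "poly ph (1 + dsize (F y) + dsize (E x)) \<le> poly ?q (dsize (E x))"
    if "(ask, x) \<in> A" "y \<in> set (l ask x)" for ask y x
  proof -
    have "dsize (F y) \<le> poly pl (dsize (E x))"
      using pl[OF that(1)] dsize_elist_member[OF that(2), of F] by linarith
    then show ?thesis by (auto simp: poly_pcompose intro!: poly_nat_mono)
  qed
  show ?thesis
  proof (rule polytimeI[where c = ?c and p = "[:3:] + pl + pa + ?q" and q = "pa + ?q"])
    fix ask x assume A: "(ask, x) \<in> A"
    obtain t s where 1: "exec ask cl (input_store (E x)) t s" "t \<le> poly pl (dsize (E x))"
      "s 0 = elist F (l ask x)" using cl[OF A] by blast
    let ?s = "(input_store (E x))(1 := s 0)"
    have first: "exec ask (Call 1 cl (Var 0)) (input_store (E x)) (1 + t) ?s"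
      by (rule exec_CallI[OF 1(1)]) simp_all
    show "\<exists>t s. exec ask ?c (input_store (E x)) t s \<and> t \<le> poly ([:3:] + pl + pa + ?q) (dsize (E x)) \<and>
        s 0 = G (case l ask x of [] \<Rightarrow> a ask x | y # ys \<Rightarrow> h ask y x)"
    proof (cases "l ask x")
      case Nil
      obtain t' s' where 2: "exec ask ca (input_store (E x)) t' s'"
        "t' \<le> poly pa (dsize (E x))" "s' 0 = G (a ask x)" using ca[OF A] by blast
      have "exec ask ?c (input_store (E x)) ((1 + t) + (1 + (1 + t'))) (?s(0 := s' 0))"
        by (intro exec.Seq[OF first] exec.IfFalse exec_CallI[OF 2(1)]) (use 1 Nil in simp_all)
      moreover have "(1 + t) + (1 + (1 + t')) \<le> poly ([:3:] + pl + pa + ?q) (dsize (E x))"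
        using 1 2 by simp
      ultimately show ?thesis by (rule exec_witness) (use 2 Nil in auto)
    next
      case (Cons y ys)
      then have y: "y \<in> set (l ask x)" by simp
      obtain t' s' where 2: "exec ask ch (input_store (DPair (F y) (E x))) t' s'"
        "t' \<le> poly ph (1 + dsize (F y) + dsize (E x))" "s' 0 = G (h ask y x)"
        using ch[OF A y] by blast
      have "exec ask ?c (input_store (E x)) ((1 + t) + (1 + (1 + t'))) (?s(0 := s' 0))"
        by (intro exec.Seq[OF first] exec.IfTrue exec_CallI[OF 2(1)]) (use 1 Cons in simp_all)
      moreover have "(1 + t) + (1 + (1 + t')) \<le> poly ([:3:] + pl + pa + ?q) (dsize (E x))"
        using 1 2 q[OF A y] by simp
      ultimately show ?thesis by (rule exec_witness) (use 2 Cons in auto)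
    qed
  next
    fix ask x assume A: "(ask, x) \<in> A"
    show "dsize (G (case l ask x of [] \<Rightarrow> a ask x | y # ys \<Rightarrow> h ask y x)) \<le> poly (pa + ?q) (dsize (E x))"
    proof (cases "l ask x")
      case Nil
      then show ?thesis using pa[OF A] by simp
    next
      case (Cons y ys)
      then have y: "y \<in> set (l ask x)" by simp
      show ?thesis using Cons ph[OF A y] q[OF A y] by simp
    qed
  qed
qed

lemma polytime_if:
  assumes "polytime A E dbool b" and f: "polytime A E G f" and g: "polytime A E G g"
  shows "polytime A E G (\<lambda>ask x. if b ask x then f ask x else g ask x)"
proof -
  \<comment> \<open>Truth values are encoded like lists of at most one unit, so a conditional is a
    case distinction on a list.\<close>
  have 1: "polytime A E (elist eunit) (\<lambda>ask x. if b ask x then [()] else [])"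
    by (rule polytime_expr[OF assms(1), where e = "Var 0" and m = 0])
      (auto simp: dbool_def eunit_def)
  have "polytime {(ask, (y, x)). (ask, x) \<in> A \<and> y \<in> set (if b ask x then [()] else [])}
      (eprod eunit E) G (\<lambda>ask p. f ask (snd p))"
    by (rule polytime_comp[OF polytime_snd[OF polytime_id] f]) auto
  from polytime_case_list[OF 1 g this]
  have "polytime A E G (\<lambda>ask x. case if b ask x then [()] else [] of [] \<Rightarrow> g ask x | y # ys \<Rightarrow> f ask x)" .
  then show ?thesis by (rule polytime_cong) simp
qed

text \<open>A polynomial step alone does not suffice: a step that doubles the size of the state
  leads to exponential values. Hence \<open>bound\<close> asks for one polynomial that controls the
  state after every initial segment of the list.\<close>

lemma polytime_foldl:
  assumes "polytime A E (elist F) l" and "polytime A E G a"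
    and "polytime {(ask, (y, s, x)). (ask, x) \<in> A \<and> y \<in> set (l ask x)} (eprod F (eprod G E)) G
          (\<lambda>ask p. h ask (fst p) (fst (snd p)) (snd (snd p)))"
    and bound: "\<And>ask x ys zs. (ask, x) \<in> A \<Longrightarrow> l ask x = ys @ zs \<Longrightarrow>
        dsize (G (foldl (\<lambda>s y. h ask y s x) (a ask x) ys)) \<le> poly q (dsize (E x))"
  shows "polytime A E G (\<lambda>ask x. foldl (\<lambda>s y. h ask y s x) (a ask x) (l ask x))"
proof -
  obtain cl pl where cl: "\<And>ask x. (ask, x) \<in> A \<Longrightarrow>
      \<exists>t s. exec ask cl (input_store (E x)) t s \<and> t \<le> poly pl (dsize (E x)) \<and> s 0 = elist F (l ask x)"
    and pl: "\<And>ask x. (ask, x) \<in> A \<Longrightarrow> dsize (elist F (l ask x)) \<le> poly pl (dsize (E x))"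
    using polytimeE[OF assms(1)] by metis
  obtain ca pa where ca: "\<And>ask x. (ask, x) \<in> A \<Longrightarrow>
      \<exists>t s. exec ask ca (input_store (E x)) t s \<and> t \<le> poly pa (dsize (E x)) \<and> s 0 = G (a ask x)"
    using polytimeE[OF assms(2)] by metis
  obtain ch ph where ch: "\<And>ask y s x. (ask, x) \<in> A \<Longrightarrow> y \<in> set (l ask x) \<Longrightarrow>
      \<exists>t s'. exec ask ch (input_store (DPair (F y) (DPair (G s) (E x)))) t s' \<and>
        t \<le> poly ph (2 + dsize (F y) + dsize (G s) + dsize (E x)) \<and> s' 0 = G (h ask y s x)"
    apply (rule polytimeE[OF assms(3)])
    subgoal premises prems for c p
      apply (rule prems(1)[of c p])
      subgoal for ask y s x
        using prems(2)[of ask "(y, s, x)"] by (simp add: add_ac)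
      done
    done
  let ?p = "pcompose ph ([:2, 1:] + pl + q)"
  let ?step = "\<lambda>ask x s y. h ask y s x"
  let ?body = "Seq (Call 2 ch (EPair (Fst (Var 1)) (EPair (Var 2) (Var 0)))) (Assign 1 (Snd (Var 1)))"
  \<comment> \<open>Variable 0 keeps the input, 1 holds the remaining list and 2 the current state.
    Apart from the called program, a round costs 3 units: the loop test, the call and the
    assignment.\<close>
  have loop: "\<exists>t s'. exec ask (While (Var 1) ?body) s t s' \<and>
      t \<le> 1 + length zs * (3 + poly ?p (dsize (E x))) \<and>
      s' 2 = G (foldl (?step ask x) (a ask x) (ys @ zs))"
    if "(ask, x) \<in> A" "l ask x = ys @ zs" "s 0 = E x" "s 1 = elist F zs"
      "s 2 = G (foldl (?step ask x) (a ask x) ys)" for ask x ys zs s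
    using that
  proof (induction zs arbitrary: ys s)
    case Nil
    have "exec ask (While (Var 1) ?body) s 1 s"
      using Nil by (intro exec.WhileFalse) simp
    then show ?case by (rule exec_witness) (use Nil in auto)
  next
    case (Cons z zs)
    let ?S = "foldl (?step ask x) (a ask x)"
    have z: "z \<in> set (l ask x)" using Cons.prems by simp
    obtain t s1 where 1: "exec ask ch (input_store (DPair (F z) (DPair (G (?S ys)) (E x)))) t s1"
      "t \<le> poly ph (2 + dsize (F z) + dsize (G (?S ys)) + dsize (E x))"
      "s1 0 = G (h ask z (?S ys) x)" using ch[OF Cons.prems(1) z] by blast
    have "dsize (F z) \<le> poly pl (dsize (E x))"
      using pl[OF Cons.prems(1)] dsize_elist_member[OF z, of F] by linarith
    moreover have "dsize (G (?S ys)) \<le> poly q (dsize (E x))"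
      using bound[OF Cons.prems(1,2)] .
    ultimately have t: "t \<le> poly ?p (dsize (E x))"
      using 1(2) by (elim order.trans) (auto simp: poly_pcompose intro!: poly_nat_mono)
    let ?s = "s(2 := s1 0)" let ?s' = "?s(1 := evalE (Snd (Var 1)) ?s)"
    have body: "exec ask ?body s ((1 + t) + 1) ?s'"
      by (rule exec.Seq[OF exec_CallI[OF 1(1)] exec.Assign]) (use Cons.prems in simp_all)
    have "\<exists>t s'. exec ask (While (Var 1) ?body) ?s' t s' \<and>
        t \<le> 1 + length zs * (3 + poly ?p (dsize (E x))) \<and> s' 2 = G (?S ((ys @ [z]) @ zs))"
      by (rule Cons.IH) (use Cons.prems 1(3) in simp_all)
    then obtain t' s2 where 2: "exec ask (While (Var 1) ?body) ?s' t' s2"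
      "t' \<le> 1 + length zs * (3 + poly ?p (dsize (E x)))"
      "s2 2 = G (?S ((ys @ [z]) @ zs))" by blast
    have "exec ask (While (Var 1) ?body) s (1 + ((1 + t) + 1) + t') s2"
      by (rule exec.WhileTrue[OF _ body 2(1)]) (use Cons.prems in simp)
    moreover have "1 + ((1 + t) + 1) + t' \<le> 1 + length (z # zs) * (3 + poly ?p (dsize (E x)))"
      using t 2(2) by (simp add: algebra_simps)
    ultimately show ?case by (rule exec_witness) (use 2(3) in auto)
  qed
  let ?c = "Seq (Call 1 cl (Var 0)) (Seq (Call 2 ca (Var 0)) (Seq (While (Var 1) ?body) (Assign 0 (Var 2))))"
  show ?thesis
  proof (rule polytimeI[where c = ?c and p = "[:4:] + pl + pa + pl * ([:3:] + ?p)" and q = q])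
    fix ask x assume A: "(ask, x) \<in> A"
    obtain t s where 1: "exec ask cl (input_store (E x)) t s" "t \<le> poly pl (dsize (E x))"
      "s 0 = elist F (l ask x)" using cl[OF A] by blast
    obtain t' s' where 2: "exec ask ca (input_store (E x)) t' s'"
      "t' \<le> poly pa (dsize (E x))" "s' 0 = G (a ask x)" using ca[OF A] by blast
    let ?s = "(input_store (E x))(1 := s 0, 2 := s' 0)"
    obtain t'' s'' where 3: "exec ask (While (Var 1) ?body) ?s t'' s''"
      "t'' \<le> 1 + length (l ask x) * (3 + poly ?p (dsize (E x)))"
      "s'' 2 = G (foldl (?step ask x) (a ask x) (l ask x))"
      using loop[OF A, of "[]" "l ask x" ?s] 1 2 by auto
    have len: "length (l ask x) \<le> poly pl (dsize (E x))"
      using pl[OF A] length_le_dsize_elist[of "l ask x" F] by linarith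
    have "exec ask ?c (input_store (E x)) ((1 + t) + ((1 + t') + (t'' + 1))) (s''(0 := evalE (Var 2) s''))"
      by (rule exec.Seq[OF exec_CallI[OF 1(1)] exec.Seq[OF exec_CallI[OF 2(1)] exec.Seq[OF 3(1) exec.Assign]]])
        simp_all
    moreover have "length (l ask x) * (3 + poly ?p (dsize (E x))) \<le>
        poly pl (dsize (E x)) * (3 + poly ?p (dsize (E x)))"
      by (rule mult_le_mono1[OF len])
    then have "(1 + t) + ((1 + t') + (t'' + 1)) \<le>
        4 + poly pl (dsize (E x)) + poly pa (dsize (E x)) +
        poly pl (dsize (E x)) * (3 + poly ?p (dsize (E x)))"
      using 1(2) 2(2) 3(2) by linarith
    then have "(1 + t) + ((1 + t') + (t'' + 1)) \<le>
        poly ([:4:] + pl + pa + pl * ([:3:] + ?p)) (dsize (E x))"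
      by (simp only: poly_add poly_mult poly_pCons poly_0 mult_zero_right add_0_right)
    ultimately show "\<exists>t s. exec ask ?c (input_store (E x)) t s \<and>
        t \<le> poly ([:4:] + pl + pa + pl * ([:3:] + ?p)) (dsize (E x)) \<and>
        s 0 = G (foldl (?step ask x) (a ask x) (l ask x))"
      by (rule exec_witness) (use 3(3) in auto)
  next
    fix ask x assume A: "(ask, x) \<in> A"
    show "dsize (G (foldl (?step ask x) (a ask x) (l ask x))) \<le> poly q (dsize (E x))"
      using bound[OF A, of "l ask x" "[]"] by simp
  qed
qed

text \<open>Rules that follow the syntax of a term, so that most programs are certified along their
  definitions. Folds are not covered, as the size of their states needs an argument in each
  case.\<close>

named_theorems polytime_intros

lemmas [polytime_intros] = polytime_id polytime_Pair polytime_fst polytime_snd polytime_Nil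
  polytime_Cons polytime_pred polytime_replicate_unit polytime_eq_atom
  polytime_case_list polytime_if

section \<open>List operations, tests and unary arithmetic\<close>

lemma foldl_Cons_eq_rev: "foldl (\<lambda>s y. y # s) s ys = rev ys @ s"
  by (induction ys arbitrary: s) auto

lemma polytime_rev [polytime_intros]:
  assumes "polytime A E (elist F) l"
  shows "polytime A E (elist F) (\<lambda>ask x. rev (l ask x))"
proof -
  obtain p :: "nat poly" where p: "\<And>ask x. (ask, x) \<in> A \<Longrightarrow> dsize (elist F (l ask x)) \<le> poly p (dsize (E x))"
    using polytimeE[OF assms] by metis
  have "polytime A E (elist F) (\<lambda>ask x. foldl (\<lambda>s y. y # s) [] (l ask x))"
  proof (rule polytime_foldl[OF assms, where q = p], goal_cases)
    case (3 ask x ys zs)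
    then show ?case using p[OF 3(1)] by (simp add: foldl_Cons_eq_rev dsize_elist rev_map[symmetric])
  qed (rule polytime_intros)+
  then show ?thesis by (simp add: foldl_Cons_eq_rev)
qed

lemma polytime_append [polytime_intros]:
  assumes "polytime A E (elist F) l" and "polytime A E (elist F) m"
  shows "polytime A E (elist F) (\<lambda>ask x. l ask x @ m ask x)"
proof -
  obtain p :: "nat poly" where p: "\<And>ask x. (ask, x) \<in> A \<Longrightarrow> dsize (elist F (l ask x)) \<le> poly p (dsize (E x))"
    using polytimeE[OF assms(1)] by metis
  obtain q :: "nat poly" where q: "\<And>ask x. (ask, x) \<in> A \<Longrightarrow> dsize (elist F (m ask x)) \<le> poly q (dsize (E x))"
    using polytimeE[OF assms(2)] by metis
  have "polytime A E (elist F) (\<lambda>ask x. foldl (\<lambda>s y. y # s) (m ask x) (rev (l ask x)))"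
  proof (rule polytime_foldl[OF polytime_rev[OF assms(1)] assms(2), where q = "p + q"], goal_cases)
    case (2 ask x ys zs)
    then have "l ask x = rev zs @ rev ys" by (metis rev_append rev_rev_ident)
    then show ?case using p[OF 2(1)] q[OF 2(1)] by (simp add: foldl_Cons_eq_rev dsize_elist rev_map[symmetric])
  qed (rule polytime_intros)+
  then show ?thesis by (simp add: foldl_Cons_eq_rev)
qed

lemma polytime_concat [polytime_intros]:
  assumes "polytime A E (elist (elist F)) l"
  shows "polytime A E (elist F) (\<lambda>ask x. concat (l ask x))"
proof -
  obtain p :: "nat poly" where p: "\<And>ask x. (ask, x) \<in> A \<Longrightarrow> dsize (elist (elist F) (l ask x)) \<le> poly p (dsize (E x))"
    using polytimeE[OF assms] by metis
  have concat: "foldl (\<lambda>s y. s @ y) s yss = s @ concat yss" for s and yss :: "'c list list"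
    by (induction yss arbitrary: s) auto
  have size: "dsize (elist F (concat yss)) \<le> dsize (elist (elist F) yss)" for yss
    by (induction yss) (auto simp: dsize_elist)
  have "polytime A E (elist F) (\<lambda>ask x. foldl (\<lambda>s y. s @ y) [] (l ask x))"
  proof (rule polytime_foldl[OF assms, where q = p], goal_cases)
    case (3 ask x ys zs)
    then have "dsize (elist (elist F) ys) \<le> dsize (elist (elist F) (l ask x))"
      by (simp add: dsize_elist)
    then show ?case using p[OF 3(1)] size[of ys] by (simp add: concat)
  qed (rule polytime_intros)+
  then show ?thesis by (simp add: concat)
qed

lemma polytime_map [polytime_intros]:
  assumes "polytime A E (elist F) l"
    and "polytime {(ask, (y, x)). (ask, x) \<in> A \<and> y \<in> set (l ask x)} (eprod F E) G
          (\<lambda>ask p. h ask (fst p) (snd p))"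
  shows "polytime A E (elist G) (\<lambda>ask x. map (\<lambda>y. h ask y x) (l ask x))"
proof -
  let ?B = "{(ask, (y, x)). (ask, x) \<in> A \<and> y \<in> set (l ask x)}"
  obtain p :: "nat poly" where p: "\<And>ask x. (ask, x) \<in> A \<Longrightarrow> dsize (elist F (l ask x)) \<le> poly p (dsize (E x))"
    using polytimeE[OF assms(1)] by metis
  obtain q :: "nat poly" where q: "\<And>ask z. (ask, z) \<in> ?B \<Longrightarrow>
      dsize (G (h ask (fst z) (snd z))) \<le> poly q (dsize (eprod F E z))"
    by (rule polytimeE[OF assms(2)]) (erule that)
  have fold: "foldl (\<lambda>s y. g y # s) s ys = rev (map g ys) @ s" for s ys and g :: "'c \<Rightarrow> 'd"
    by (induction ys arbitrary: s) auto
  let ?q = "pcompose q ([:1, 1:] + p)"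
  have "polytime A E (elist G) (\<lambda>ask x. foldl (\<lambda>s y. h ask y x # s) [] (l ask x))"
  proof (rule polytime_foldl[OF assms(1), where q = "[:1:] + p * ([:1:] + ?q)"], goal_cases)
    case 1
    show ?case by (rule polytime_intros)
  next
    case 2
    have "polytime {(ask, (y, s, x)). (ask, x) \<in> A \<and> y \<in> set (l ask x)} (eprod F (eprod (elist G) E)) G
         (\<lambda>ask p. (\<lambda>ask z. h ask (fst z) (snd z)) ask (fst p, snd (snd p)))"
      by (rule polytime_comp[OF _ assms(2)]) (rule polytime_intros | force)+
    then have "polytime {(ask, (y, s, x)). (ask, x) \<in> A \<and> y \<in> set (l ask x)} (eprod F (eprod (elist G) E)) G
         (\<lambda>ask p. h ask (fst p) (snd (snd p)))" by simp
    then show ?case by - (rule polytime_intros | assumption)+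
  next
    case (3 ask x ys zs)
    have "dsize (G (h ask y x)) \<le> poly ?q (dsize (E x))" if "y \<in> set ys" for y
    proof -
      have y: "y \<in> set (l ask x)" using that 3 by simp
      then have "dsize (G (h ask y x)) \<le> poly q (1 + dsize (F y) + dsize (E x))"
        using q[of ask "(y, x)"] 3(1) by simp
      moreover have "dsize (F y) \<le> poly p (dsize (E x))"
        using p[OF 3(1)] dsize_elist_member[OF y, of F] by linarith
      ultimately show ?thesis
        by (elim order.trans) (auto simp: poly_pcompose intro!: poly_nat_mono)
    qed
    then have "dsize (elist G (rev (map (\<lambda>y. h ask y x) ys))) \<le> 1 + length ys * (1 + poly ?q (dsize (E x)))"
      using dsize_elist_le[of "rev (map (\<lambda>y. h ask y x) ys)" G] by auto
    moreover have "length ys \<le> poly p (dsize (E x))"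
      using p[OF 3(1)] length_le_dsize_elist[of "l ask x" F] 3(2) by simp
    then have "length ys * (1 + poly ?q (dsize (E x))) \<le> poly p (dsize (E x)) * (1 + poly ?q (dsize (E x)))"
      by (rule mult_le_mono1)
    ultimately show ?case by (simp add: fold)
  qed
  from polytime_rev[OF this] show ?thesis by (simp add: fold)
qed

lemma polytime_filter [polytime_intros]:
  assumes "polytime A E (elist F) l"
    and "polytime {(ask, (y, x)). (ask, x) \<in> A \<and> y \<in> set (l ask x)} (eprod F E) dbool
          (\<lambda>ask p. P ask (fst p) (snd p))"
  shows "polytime A E (elist F) (\<lambda>ask x. filter (\<lambda>y. P ask y x) (l ask x))"
proof -
  have filter: "concat (map (\<lambda>y. if Q y then [y] else []) ys) = filter Q ys" for Q and ys :: "'c list"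
    by (induction ys) auto
  have "polytime A E (elist F) (\<lambda>ask x. concat (map (\<lambda>y. if P ask y x then [y] else []) (l ask x)))"
    by (rule polytime_intros assms)+
  then show ?thesis by (simp add: filter)
qed

lemma polytime_True [polytime_intros]: "polytime A E dbool (\<lambda>ask x. True)"
  by (rule polytime_expr[OF polytime_id, where e = "EPair ENil ENil" and m = 3])
    (auto simp: dbool_def)

lemma polytime_False [polytime_intros]: "polytime A E dbool (\<lambda>ask x. False)"
  by (rule polytime_expr[OF polytime_id, where e = ENil and m = 3]) (auto simp: dbool_def)

lemma polytime_not [polytime_intros]:
  assumes "polytime A E dbool P"
  shows "polytime A E dbool (\<lambda>ask x. \<not> P ask x)"
proof -
  have "polytime A E dbool (\<lambda>ask x. if P ask x then False else True)"
    by (rule polytime_intros assms)+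
  then show ?thesis by (rule polytime_cong) simp
qed

lemma polytime_conj [polytime_intros]:
  assumes "polytime A E dbool P" and "polytime A E dbool Q"
  shows "polytime A E dbool (\<lambda>ask x. P ask x \<and> Q ask x)"
proof -
  have "polytime A E dbool (\<lambda>ask x. if P ask x then Q ask x else False)"
    by (rule polytime_intros assms)+
  then show ?thesis by (rule polytime_cong) simp
qed

lemma polytime_disj [polytime_intros]:
  assumes "polytime A E dbool P" and "polytime A E dbool Q"
  shows "polytime A E dbool (\<lambda>ask x. P ask x \<or> Q ask x)"
proof -
  have "polytime A E dbool (\<lambda>ask x. if P ask x then True else Q ask x)"
    by (rule polytime_intros assms)+
  then show ?thesis by (rule polytime_cong) simp
qed

lemma polytime_Bex [polytime_intros]:
  assumes "polytime A E (elist F) l"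
    and "polytime {(ask, (y, x)). (ask, x) \<in> A \<and> y \<in> set (l ask x)} (eprod F E) dbool
          (\<lambda>ask p. P ask (fst p) (snd p))"
  shows "polytime A E dbool (\<lambda>ask x. \<exists>y \<in> set (l ask x). P ask y x)"
proof -
  have "polytime A E dbool (\<lambda>ask x. case filter (\<lambda>y. P ask y x) (l ask x) of [] \<Rightarrow> False | y # ys \<Rightarrow> True)"
    by (rule polytime_intros assms)+
  then show ?thesis
    by (rule polytime_cong) (auto split: list.splits simp: filter_empty_conv filter_eq_Cons_iff)
qed

lemma polytime_member_atom [polytime_intros]:
  assumes "polytime A E DAtom f" and "polytime A E (elist DAtom) l"
  shows "polytime A E dbool (\<lambda>ask x. f ask x \<in> set (l ask x))"
proof -
  have "polytime {(ask, (y, x)). (ask, x) \<in> A \<and> y \<in> set (l ask x)} (eprod DAtom E) DAtom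
      (\<lambda>ask p. f ask (snd p))"
    by (rule polytime_comp[OF polytime_snd[OF polytime_id] assms(1)]) auto
  then have "polytime A E dbool (\<lambda>ask x. \<exists>y \<in> set (l ask x). y = f ask x)"
    by - (rule polytime_intros assms | assumption)+
  then show ?thesis by simp
qed

lemma polytime_length [polytime_intros]:
  assumes "polytime A E (elist F) l"
  shows "polytime A E dnat (\<lambda>ask x. length (l ask x))"
proof -
  have "polytime {(ask, (y, x)). (ask, x) \<in> A \<and> y \<in> set (l ask x)} (eprod F E) eunit (\<lambda>ask p. ())"
    by (rule polytime_expr[OF polytime_id, where e = ENil and m = 1]) (auto simp: eunit_def)
  then have "polytime A E (elist eunit) (\<lambda>ask x. map (\<lambda>_. ()) (l ask x))"
    by - (rule polytime_map assms | assumption)+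
  from polytime_length_unit[OF this] show ?thesis by simp
qed

text \<open>A counting loop whose state is always \<open>[0..<i]\<close>, so that its length is the
  next entry.\<close>

lemma polytime_upt [polytime_intros]:
  assumes "polytime A E dnat f"
  shows "polytime A E (elist dnat) (\<lambda>ask x. [0..<f ask x])"
proof -
  obtain p :: "nat poly" where p: "\<And>ask x. (ask, x) \<in> A \<Longrightarrow> dsize (dnat (f ask x) :: 'a data) \<le> poly p (dsize (E x))"
    using polytimeE[OF assms] by metis
  have fold: "foldl (\<lambda>s y. s @ [length s]) [] ys = [0..<length ys]" for ys :: "unit list"
    by (induction ys rule: rev_induct) auto
  have "polytime A E (elist dnat) (\<lambda>ask x. foldl (\<lambda>s y. s @ [length s]) [] (replicate (f ask x) ()))"
  proof (rule polytime_foldl[OF polytime_replicate_unit[OF assms], where q = "[:1:] + p * ([:2:] + [:2:] * p)"], goal_cases)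
    case (3 ask x ys zs)
    have "length ys \<le> f ask x"
      using arg_cong[OF 3(2), of length] by simp
    then have len: "length ys \<le> poly p (dsize (E x))"
      using p[OF 3(1)] by (simp add: dsize_dnat)
    have "dsize (elist dnat [0..<length ys] :: 'a data) \<le> 1 + length ys * (1 + (2 * length ys + 1))"
      using dsize_elist_le[of "[0..<length ys]" dnat "2 * length ys + 1"] by (auto simp: dsize_dnat)
    also have "\<dots> \<le> 1 + poly p (dsize (E x)) * (1 + (2 * poly p (dsize (E x)) + 1))"
      using len by (intro add_mono mult_mono) auto
    finally show ?case by (simp add: fold)
  qed (rule polytime_intros)+
  then show ?thesis by (simp add: fold)
qed

lemma polytime_minus [polytime_intros]:
  assumes "polytime A E dnat f" and "polytime A E dnat g"
  shows "polytime A E dnat (\<lambda>ask x. f ask x - g ask x)"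
proof -
  obtain p :: "nat poly" where p: "\<And>ask x. (ask, x) \<in> A \<Longrightarrow> dsize (dnat (f ask x) :: 'a data) \<le> poly p (dsize (E x))"
    using polytimeE[OF assms(1)] by metis
  have fold: "foldl (\<lambda>s y. s - Suc 0) m ys = m - length ys" for m :: nat and ys :: "unit list"
    by (induction ys rule: rev_induct) auto
  have "polytime A E dnat (\<lambda>ask x. foldl (\<lambda>s y. s - 1) (f ask x) (replicate (g ask x) ()))"
  proof (rule polytime_foldl[OF polytime_replicate_unit[OF assms(2)] assms(1), where q = p], goal_cases)
    case (2 ask x ys zs)
    show ?case using p[OF 2(1)] by (simp add: fold dsize_dnat)
  qed (rule polytime_intros)+
  then show ?thesis by (simp add: fold)
qed

text \<open>Two numbers agree if both truncated differences vanish, and a number is zero if the list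
  counting up to it is empty.\<close>

lemma polytime_eq_nat [polytime_intros]:
  assumes "polytime A E dnat f" and "polytime A E dnat g"
  shows "polytime A E dbool (\<lambda>ask x. f ask x = g ask x)"
proof -
  have "polytime A E dbool (\<lambda>ask x.
      (case [0..<f ask x - g ask x] of [] \<Rightarrow> True | y # ys \<Rightarrow> False) \<and>
      (case [0..<g ask x - f ask x] of [] \<Rightarrow> True | y # ys \<Rightarrow> False))"
    by (rule polytime_intros assms)+
  then show ?thesis
    by (rule polytime_cong) (auto split: list.splits simp: upt_eq_Nil_conv upt_eq_Cons_conv)
qed

lemma polytime_mult [polytime_intros]:
  assumes "polytime A E dnat f" and "polytime A E dnat g"
  shows "polytime A E dnat (\<lambda>ask x. f ask x * g ask x)"
proof -
  have g: "polytime {(ask, (y, x)). (ask, x) \<in> A \<and> y \<in> set [0..<f ask x]} (eprod dnat E) dnat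
      (\<lambda>ask p. g ask (snd p))"
    by (rule polytime_comp[OF polytime_snd[OF polytime_id] assms(2)]) auto
  have "polytime A E dnat (\<lambda>ask x. length (concat (map (\<lambda>_. [0..<g ask x]) [0..<f ask x])))"
    by (rule polytime_intros assms g)+
  then show ?thesis by (rule polytime_cong) (simp add: length_concat comp_def sum_list_const_mult sum_list_triv)
qed

text \<open>An increment that depends on the fixed input only, and not on the state, cannot compound
  over the rounds. The folds of the coloring program are all bounded in this way.\<close>

lemma polytime_foldl_additive:
  assumes "polytime A E (elist F) l" and "polytime A E G a"
    and "polytime {(ask, (y, s, x)). (ask, x) \<in> A \<and> y \<in> set (l ask x)} (eprod F (eprod G E)) G
          (\<lambda>ask p. h ask (fst p) (fst (snd p)) (snd (snd p)))"
    and step: "\<And>ask x y s. (ask, x) \<in> A \<Longrightarrow> y \<in> set (l ask x) \<Longrightarrow>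
        dsize (G (h ask y s x)) \<le> dsize (G s) + poly q (dsize (E x))"
  shows "polytime A E G (\<lambda>ask x. foldl (\<lambda>s y. h ask y s x) (a ask x) (l ask x))"
proof -
  obtain p :: "nat poly" where p: "\<And>ask x. (ask, x) \<in> A \<Longrightarrow> dsize (elist F (l ask x)) \<le> poly p (dsize (E x))"
    using polytimeE[OF assms(1)] by metis
  obtain r :: "nat poly" where r: "\<And>ask x. (ask, x) \<in> A \<Longrightarrow> dsize (G (a ask x)) \<le> poly r (dsize (E x))"
    using polytimeE[OF assms(2)] by metis
  show ?thesis
  proof (rule polytime_foldl[OF assms(1-3), where q = "r + p * q"])
    fix ask x ys zs assume A: "(ask, x) \<in> A" and "l ask x = ys @ zs"
    then have "set ys \<subseteq> set (l ask x)" "length ys \<le> length (l ask x)" by auto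
    from this(1) have "dsize (G (foldl (\<lambda>s y. h ask y s x) (a ask x) ys)) \<le>
        dsize (G (a ask x)) + length ys * poly q (dsize (E x))"
    proof (induction ys rule: rev_induct)
      case (snoc y ys)
      then show ?case using step[OF A, of y "foldl (\<lambda>s y. h ask y s x) (a ask x) ys"] by simp
    qed simp
    moreover have "length ys \<le> poly p (dsize (E x))"
      using p[OF A] length_le_dsize_elist[of "l ask x" F] \<open>length ys \<le> _\<close> by linarith
    then have "length ys * poly q (dsize (E x)) \<le> poly p (dsize (E x)) * poly q (dsize (E x))"
      by (rule mult_le_mono1)
    ultimately show "dsize (G (foldl (\<lambda>s y. h ask y s x) (a ask x) ys)) \<le> poly (r + p * q) (dsize (E x))"
      using r[OF A] by (simp only: poly_add poly_mult)
  qed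
qed

section \<open>Token walks in graphs of bounded degree\<close>

text \<open>There are no assumptions, because the running time is to be bounded on all inputs. The
  properties of the graph enter with \<open>bounded_graph\<close>, for correctness.\<close>

locale token_walk =
  fixes G :: "'a \<Rightarrow> 'a \<Rightarrow> bool" and V :: "'a list" and D :: nat
begin

text \<open>Colorings are association lists: recoloring prepends an entry and \<open>map_of\<close>
  reads the latest one, so a move enlarges the list by one entry only.\<close>

definition available :: "('a \<times> nat) list \<Rightarrow> 'a \<Rightarrow> nat list" where
  "available f x = filter (\<lambda>a. \<not> (\<exists>v \<in> set V. G x v \<and> map_of f v = Some a)) [0..<D]"

text \<open>The first component of a state holds the token, the only vertex still to be colored;
  the token's entry in the coloring is meaningless. A move along color \<open>a\<close> gives the token's
  vertex the color \<open>a\<close> and passes the token to the neighbor that had it.\<close>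

definition walk_step :: "'a list \<times> ('a \<times> nat) list \<Rightarrow> nat \<Rightarrow> 'a list \<times> ('a \<times> nat) list" where
  "walk_step s a = (case fst s of [] \<Rightarrow> s | x # _ \<Rightarrow>
     (case available (snd s) x of
        c # _ \<Rightarrow> ([], (x, c) # snd s)
      | [] \<Rightarrow> (case filter (\<lambda>u. G x u \<and> map_of (snd s) u = Some a) V of
            [] \<Rightarrow> s | u # _ \<Rightarrow> ([u], (x, a) # snd s))))"

text \<open>With \<open>2 * length V\<close> letters the word outlasts any path without repeated
  vertices.\<close>

definition zigzag :: "nat \<Rightarrow> nat \<Rightarrow> nat list" where
  "zigzag b d = concat (map (\<lambda>_. [b, d]) V)"

text \<open>The prefix \<open>a, c, a\<close> has two uses. If \<open>a\<close> and \<open>c\<close>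
  are the colors of two adjacent neighbors of the token, it leads round this triangle and exchanges
  the two colors. For \<open>c = a\<close> it leads to a neighbor and back, and its last letter
  begins the Kempe chain that \<open>zigzag\<close> continues.\<close>

definition walks :: "nat list list" where
  "walks = concat (map (\<lambda>a. concat (map (\<lambda>c. concat (map (\<lambda>b. map (\<lambda>d.
     [a, c, a] @ zigzag b d) [0..<D]) [0..<D])) [0..<D])) [0..<D])"

text \<open>\<open>V\<close> may list a vertex repeatedly, so vertices with an entry are left alone.
  The default \<open>f\<close> for the case that no walk succeeds is not reached in a
  \<open>clique_like_graph\<close> when \<open>f\<close> is proper.\<close>

definition insert_color :: "('a \<times> nat) list \<Rightarrow> 'a \<Rightarrow> ('a \<times> nat) list" where
  "insert_color f x = (if x \<in> set (map fst f) then f else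
     case filter (\<lambda>s. fst s = []) (map (\<lambda>w. foldl walk_step ([x], f) w) walks) of
       [] \<Rightarrow> f | s # _ \<Rightarrow> snd s)"

definition color_classes :: "'a list list" where
  "color_classes = map (\<lambda>a. filter (\<lambda>v. map_of (foldl insert_color [] V) v = Some a) V) [0..<D]"

end

section \<open>Proper partial colorings and stuck tokens\<close>

locale bounded_graph = token_walk +
  assumes sym: "G u v \<Longrightarrow> G v u"
    and irrefl: "\<not> G u u"
    and in_V: "G u v \<Longrightarrow> v \<in> set V"
    and degree: "card {v. G u v} \<le> D"
begin

lemma finite_nbrs: "finite {v. G u v}"
  by (rule finite_subset[of _ "set V"]) (auto dest: in_V)

definition stuck :: "('a \<Rightarrow> nat option) \<Rightarrow> 'a \<Rightarrow> bool" where
  "stuck f x \<longleftrightarrow> (\<forall>a < D. \<exists>v. G x v \<and> f v = Some a)"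

text \<open>All \<open>D\<close> colors occur on at most \<open>D\<close> neighbors, so by the
  pigeonhole principle the coloring is a bijection from the neighbors to the colors.\<close>

lemma stuck_bij:
  assumes "stuck f x"
  shows "card {v. G x v} = D" and "inj_on f {v. G x v}" and "f ` {v. G x v} = Some ` {..<D}"
proof -
  have sub: "Some ` {..<D} \<subseteq> f ` {v. G x v}"
  proof
    fix c assume "c \<in> Some ` {..<D}"
    then obtain a where "a < D" "c = Some a" by auto
    then show "c \<in> f ` {v. G x v}"
      using assms unfolding stuck_def by (metis image_eqI mem_Collect_eq)
  qed
  have "D = card (Some ` {..<D})" by (simp add: card_image)
  also have "\<dots> \<le> card (f ` {v. G x v})"
    using sub finite_nbrs by (intro card_mono) auto
  finally have D: "D \<le> card (f ` {v. G x v})" .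
  with card_image_le[OF finite_nbrs, of f x] degree[of x]
  have eq: "card (f ` {v. G x v}) = card {v. G x v}" "card {v. G x v} = D" by linarith+
  show "card {v. G x v} = D" by (rule eq(2))
  show "inj_on f {v. G x v}" by (rule eq_card_imp_inj_on[OF finite_nbrs eq(1)])
  have "card (Some ` {..<D}) = card (f ` {v. G x v})"
    unfolding eq by (simp add: card_image)
  then have "Some ` {..<D} = f ` {v. G x v}"
    by (rule card_subset_eq[OF finite_imageI[OF finite_nbrs] sub])
  then show "f ` {v. G x v} = Some ` {..<D}" by (rule HOL.sym)
qed

lemma stuck_unique:
  assumes "stuck f x" and "G x u" and "G x v" and "f u = f v"
  shows "u = v"
  by (rule inj_onD[OF stuck_bij(2)[OF assms(1)] assms(4)]) (use assms in simp_all)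

lemma stuck_colored:
  assumes "stuck f x" and "G x u"
  obtains a where "a < D" and "f u = Some a"
proof -
  have "f u \<in> f ` {v. G x v}" using assms(2) by simp
  then have "f u \<in> Some ` {..<D}" unfolding stuck_bij(3)[OF assms(1)] .
  then show thesis using that by auto
qed

text \<open>Vertices in \<open>X\<close>, in practice the one with the token, may carry a stale
  entry that does not count. Since \<open>f\<close> is partial, other vertices may be
  uncolored.\<close>

definition proper :: "('a \<Rightarrow> nat option) \<Rightarrow> 'a set \<Rightarrow> bool" where
  "proper f X \<longleftrightarrow>
     (\<forall>u v a. G u v \<longrightarrow> u \<notin> X \<longrightarrow> v \<notin> X \<longrightarrow> f u = Some a \<longrightarrow> f v \<noteq> Some a) \<and>
     (\<forall>u a. u \<notin> X \<longrightarrow> f u = Some a \<longrightarrow> a < D)"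

text \<open>Covers both kinds of moves: \<open>X\<close> is empty if \<open>c\<close> is a free
  color of \<open>x\<close>, and it is the new place of the token if exactly one neighbor has the
  color \<open>c\<close>.\<close>

lemma proper_upd:
  assumes "proper f {x}" and "c < D" and "\<And>v. G x v \<Longrightarrow> v \<notin> X \<Longrightarrow> f v \<noteq> Some c"
  shows "proper (f(x \<mapsto> c)) X"
proof -
  have "(f(x \<mapsto> c)) v \<noteq> Some a"
    if uv: "G u v" "u \<notin> X" "v \<notin> X" and a: "(f(x \<mapsto> c)) u = Some a" for u v a
  proof (cases "u = x")
    case True
    then have "v \<noteq> x" using uv(1) irrefl by blast
    then show ?thesis using assms(3)[of v] True uv a by simp
  next
    case False
    then have u: "f u = Some a" using a by simp
    show ?thesis
    proof (cases "v = x")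
      case True
      then show ?thesis using assms(3)[OF sym[of u x]] uv u by auto
    next
      case v: False
      then show ?thesis using assms(1) False uv(1) u unfolding proper_def by simp
    qed
  qed
  moreover have "a < D" if "(f(x \<mapsto> c)) u = Some a" for u a
    using that assms(1,2) unfolding proper_def by (cases "u = x") auto
  ultimately show ?thesis unfolding proper_def by blast
qed

lemma available_Nil_iff: "available f x = [] \<longleftrightarrow> stuck (map_of f) x"
  using in_V by (fastforce simp: available_def stuck_def filter_empty_conv)

lemma available_Cons:
  assumes "available f x = c # cs"
  shows "c < D" and "G x v \<Longrightarrow> map_of f v \<noteq> Some c"
proof -
  have "c \<in> set (available f x)" using assms by simp
  then show "c < D" "G x v \<Longrightarrow> map_of f v \<noteq> Some c"
    by (auto simp: available_def dest: in_V)
qed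

definition valid_state :: "'a set \<Rightarrow> 'a list \<times> ('a \<times> nat) list \<Rightarrow> bool" where
  "valid_state S s \<longleftrightarrow> length (fst s) \<le> 1 \<and> proper (map_of (snd s)) (set (fst s)) \<and>
     set (fst s) \<union> dom (map_of (snd s)) = S"

lemma valid_state_step:
  assumes "valid_state S s" and "a < D"
  shows "valid_state S (walk_step s a)"
proof (cases "fst s")
  case Nil
  then show ?thesis using assms by (simp add: walk_step_def)
next
  case (Cons x xs)
  let ?f = "map_of (snd s)"
  have x: "fst s = [x]" "proper ?f {x}" "insert x (dom ?f) = S"
    using assms(1) Cons by (auto simp: valid_state_def)
  show ?thesis
  proof (cases "available (snd s) x")
    case (Cons c cs)
    have "proper (?f(x \<mapsto> c)) {}"
      by (rule proper_upd[OF x(2)]) (use available_Cons[OF Cons] in auto)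
    then show ?thesis
      using x Cons by (auto simp: walk_step_def valid_state_def fun_upd_def split: if_splits)
  next
    case Nil
    then have st: "stuck ?f x" by (simp add: available_Nil_iff)
    show ?thesis
    proof (cases "filter (\<lambda>u. G x u \<and> ?f u = Some a) V")
      case Nil
      with \<open>available (snd s) x = []\<close> show ?thesis using assms x(1) by (simp add: walk_step_def)
    next
      case (Cons u us)
      then have "u \<in> set (filter (\<lambda>u. G x u \<and> ?f u = Some a) V)" by simp
      then have u: "G x u" "?f u = Some a" by auto
      have "proper (?f(x \<mapsto> a)) {u}"
        by (rule proper_upd[OF x(2) assms(2)]) (use stuck_unique[OF st u(1)] u(2) in force)
      then show ?thesis
        using x Cons Nil u by (auto simp: walk_step_def valid_state_def fun_upd_def split: if_splits)
    qed
  qed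
qed

lemma valid_state_walk:
  "valid_state S s \<Longrightarrow> \<forall>a \<in> set w. a < D \<Longrightarrow> valid_state S (foldl walk_step s w)"
proof (induction w arbitrary: s)
  case (Cons a w)
  then show ?case using valid_state_step[of S s a] by simp
qed simp

lemma walk_done: "fst s = [] \<Longrightarrow> foldl walk_step s w = s"
  by (induction w) (auto simp: walk_step_def)

section \<open>Walks that never free the token, and Kempe chains\<close>

fun fails :: "nat list \<Rightarrow> ('a \<Rightarrow> nat option) \<Rightarrow> 'a \<Rightarrow> bool" where
  "fails [] f x \<longleftrightarrow> True"
| "fails (a # w) f x \<longleftrightarrow> stuck f x \<and> (\<forall>u. G x u \<longrightarrow> f u = Some a \<longrightarrow> fails w (f(x \<mapsto> a)) u)"

text \<open>Once a free color is found, the state no longer changes. A walk that ends with its token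
  was therefore stuck before each move, and then the neighbor selected by the program is the only
  one of its color.\<close>

lemma fails_if_not_done:
  "fst (foldl walk_step ([x], f) w) \<noteq> [] \<Longrightarrow> \<forall>a \<in> set w. a < D \<Longrightarrow> fails w (map_of f) x"
proof (induction w arbitrary: x f)
  case (Cons a w)
  have av: "available f x = []"
  proof (cases "available f x")
    case (Cons c cs)
    then have "fst (walk_step ([x], f) a) = []" by (simp add: walk_step_def)
    with Cons.prems(1) show ?thesis by (simp add: walk_done)
  qed
  then have st: "stuck (map_of f) x" by (simp add: available_Nil_iff)
  have "fails w ((map_of f)(x \<mapsto> a)) u" if u: "G x u" "map_of f u = Some a" for u
  proof -
    have "u \<in> set (filter (\<lambda>u. G x u \<and> map_of f u = Some a) V)" using u in_V by simp
    then obtain u' us where u': "filter (\<lambda>u. G x u \<and> map_of f u = Some a) V = u' # us"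
      by (cases "filter (\<lambda>u. G x u \<and> map_of f u = Some a) V") auto
    then have "u' \<in> set (filter (\<lambda>u. G x u \<and> map_of f u = Some a) V)" by simp
    then have "u' = u" using stuck_unique[OF st, of u' u] u by auto
    then have "walk_step ([x], f) a = ([u], (x, a) # f)"
      using av u' by (simp add: walk_step_def)
    then show ?thesis using Cons.IH[of u "(x, a) # f"] Cons.prems by (simp add: fun_upd_def)
  qed
  with st show ?case by simp
qed simp

lemma zigzag_eq: "zigzag b d = map (\<lambda>i. if even i then b else d) [0..<2 * length V]"
  unfolding zigzag_def by (induction V rule: rev_induct) auto

lemma (in -) in_set_concat_map: "x \<in> set (concat (map f xs)) \<longleftrightarrow> (\<exists>y \<in> set xs. x \<in> set (f y))"
  by simp

lemma walks_memI:
  assumes "a < D" "c < D" "b < D" "d < D"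
  shows "[a, c, a] @ zigzag b d \<in> set walks"
  unfolding walks_def in_set_concat_map
  by (rule bexI[of _ a], rule bexI[of _ c], rule bexI[of _ b], unfold set_map, rule imageI)
    (use assms in simp_all)

lemma walks_bounded: "w \<in> set walks \<Longrightarrow> \<forall>a \<in> set w. a < D"
  by (auto simp: walks_def zigzag_def split: if_splits)

text \<open>A token that alternates between two colors travels along a Kempe chain. As it never gets
  unstuck, it cannot meet a vertex of the chain again other than its starting point.\<close>

lemma kempe_cycle:
  assumes "proper f {x}" and "a \<noteq> b"
    and "a < D" and "b < D" and "fails (a # zigzag b a) f x"
  obtains w L where "w 0 = x" and "inj_on w {..L}" and "\<And>i. i < L \<Longrightarrow> G (w i) (w (Suc i))"
    and "\<And>i. 1 \<le> i \<Longrightarrow> i \<le> L \<Longrightarrow> f (w i) = Some (if odd i then a else b)"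
    and "even L" and "2 \<le> L" and "L \<le> length V" and "G (w L) x"
proof (rule ccontr)
  assume "\<not> thesis"
  note no_cycle = this and found = that
  define c where "c i = (if odd i then a else b)" for i :: nat
  \<comment> \<open>Letter \<open>c i\<close> brings the token to the \<open>i\<close>-th vertex of
    the chain; the letters \<open>c 1, ..., c (m - 1)\<close> are \<open>2 * length V + 1\<close> in
    number.\<close>
  define m where "m = 2 * length V + 2"
  have "a # zigzag b a = map c [1..<m]"
  proof (rule nth_equalityI)
    fix i assume "i < length (a # zigzag b a)"
    then show "(a # zigzag b a) ! i = map c [1..<m] ! i"
      by (cases i) (auto simp: zigzag_eq c_def m_def simp del: upt_Suc)
  qed (simp add: zigzag_eq m_def del: upt_Suc)
  with assms(5) have word: "fails (map c [1..<m]) f x" by simp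
  \<comment> \<open>The state after \<open>j\<close> moves along the path
    \<open>w 0, ..., w j\<close>: \<open>f\<close> is the coloring at the start and \<open>h\<close>
    the present one, in which each vertex left behind has taken over the color of its
    successor.\<close>
  define P where "P j w h \<longleftrightarrow> w 0 = x \<and> inj_on w {..j} \<and> (\<forall>i<j. G (w i) (w (Suc i))) \<and>
      (\<forall>i. 1 \<le> i \<and> i \<le> j \<longrightarrow> f (w i) = Some (c i)) \<and>
      fails (map c [Suc j..<m]) h (w j) \<and>
      (\<forall>u. u \<notin> w ` {..<j} \<longrightarrow> h u = f u) \<and> (\<forall>i<j. h (w i) = Some (c (Suc i)))" for j w h
  have P0: "w 0 = x" and P_inj: "inj_on w {..j}" and P_G: "\<And>i. i < j \<Longrightarrow> G (w i) (w (Suc i))"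
    and P_f: "\<And>i. 1 \<le> i \<Longrightarrow> i \<le> j \<Longrightarrow> f (w i) = Some (c i)"
    and P_fails: "fails (map c [Suc j..<m]) h (w j)"
    and P_h: "\<And>u. u \<notin> w ` {..<j} \<Longrightarrow> h u = f u" "\<And>i. i < j \<Longrightarrow> h (w i) = Some (c (Suc i))"
    if "P j w h" for j w h
    using that unfolding P_def by blast+
  have len: "j \<le> length V" if P: "P j w h" for j w h
  proof -
    have "w ` {1..j} \<subseteq> set V"
    proof
      fix v assume "v \<in> w ` {1..j}"
      then obtain i where i: "1 \<le> i" "i \<le> j" "v = w i" by auto
      then have "G (w (i - 1)) (w i)" using P_G[OF P, of "i - 1"] by simp
      then show "v \<in> set V" using in_V i by simp
    qed
    then have "card (w ` {1..j}) \<le> card (set V)" by (intro card_mono) auto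
    moreover have "card (w ` {1..j}) = j"
      using inj_on_subset[OF P_inj[OF P], of "{1..j}"] by (subst card_image) auto
    ultimately show ?thesis using card_length[of V] by linarith
  qed
  \<comment> \<open>A chain that never closes up could be continued for \<open>length V + 1\<close>
    moves, in contradiction to \<open>len\<close>.\<close>
  have "\<exists>w h. P j w h" if "j \<le> length V + 1" for j
    using that
  proof (induction j)
    case 0
    have "P 0 (\<lambda>_. x) f" using word by (simp add: P_def)
    then show ?case by blast
  next
    case (Suc j)
    then obtain w h where P: "P j w h" by auto
    have "j < m - 1" using Suc.prems by (simp add: m_def)
    then have "[Suc j..<m] = Suc j # [Suc (Suc j)..<m]" by (simp add: upt_conv_Cons)
    with P_fails[OF P] have st: "stuck h (w j)"
      and step: "\<And>u. G (w j) u \<Longrightarrow> h u = Some (c (Suc j)) \<Longrightarrow>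
          fails (map c [Suc (Suc j)..<m]) (h(w j \<mapsto> c (Suc j))) u" by auto
    have "c (Suc j) < D" using assms(3,4) by (simp add: c_def)
    then obtain u where u: "G (w j) u" "h u = Some (c (Suc j))" using st by (auto simp: stuck_def)
    show ?case
    proof (cases "u \<in> w ` {..j}")
      case True
      then obtain i where i: "i \<le> j" "u = w i" by auto
      then have ij: "i < j" using u irrefl by (cases "i = j") auto
      \<comment> \<open>A visited vertex \<open>w i\<close> now has the color of its successor, so
        meeting it again forces \<open>i\<close> and \<open>j\<close> to have the same parity. For
        \<open>i = 0\<close> the chain closes up; otherwise the adjacent vertices \<open>w i\<close>
        and \<open>w j\<close> had equal colors under \<open>f\<close>.\<close>
      then have "c (Suc i) = c (Suc j)" using P_h(2)[OF P ij] u i by simp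
      then have par: "even i \<longleftrightarrow> even j" using assms(2) by (auto simp: c_def split: if_splits)
      show ?thesis
      proof (cases "i = 0")
        case True
        then have j: "even j" "2 \<le> j" using par ij by (auto elim!: evenE)
        have "G (w j) x" using u i True P0[OF P] by simp
        moreover have "f (w i) = Some (if odd i then a else b)" if "1 \<le> i" "i \<le> j" for i
          using P_f[OF P that] by (simp add: c_def)
        ultimately have thesis
          using found[of w j] P0[OF P] P_inj[OF P] P_G[OF P] j len[OF P] by blast
        with no_cycle show ?thesis ..
      next
        case False
        have "w i \<noteq> x" "w j \<noteq> x"
          using inj_onD[OF P_inj[OF P], of i 0] inj_onD[OF P_inj[OF P], of j 0] ij False P0[OF P]
          by auto
        moreover have "f (w i) = Some (c i)" "f (w j) = Some (c j)" "c i = c j"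
          using P_f[OF P, of i] P_f[OF P, of j] ij False par by (auto simp: c_def)
        ultimately have False
          using assms(1) u(1) i(2) unfolding proper_def by simp
        then show ?thesis ..
      qed
    next
      case False
      define w' where "w' = w(Suc j := u)"
      have w': "w' i = w i" if "i \<le> j" for i using that by (simp add: w'_def)
      have w'_Suc: "w' (Suc j) = u" by (simp add: w'_def)
      have image: "w' ` {..j} = w ` {..j}" using w' by auto
      have "P (Suc j) w' (h(w j \<mapsto> c (Suc j)))"
        unfolding P_def
      proof (intro conjI allI impI)
        show "w' 0 = x" using P0[OF P] w' by simp
        have "inj_on w' {..j}" using P_inj[OF P] w' by (simp add: inj_on_def)
        then show "inj_on w' {..Suc j}" using False image by (simp add: atMost_Suc w'_Suc)
        show "G (w' i) (w' (Suc i))" if "i < Suc j" for i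
          using that P_G[OF P, of i] u(1) by (cases "i = j") (simp_all add: w' w'_Suc)
        show "f (w' i) = Some (c i)" if "1 \<le> i \<and> i \<le> Suc j" for i
        proof (cases "i = Suc j")
          case True
          have "u \<notin> w ` {..<j}" using False by auto
          from P_h(1)[OF P this] show ?thesis using u(2) True by (simp add: w'_Suc)
        next
          case False
          then show ?thesis using P_f[OF P, of i] that by (simp add: w')
        qed
        show "fails (map c [Suc (Suc j)..<m]) (h(w j \<mapsto> c (Suc j))) (w' (Suc j))"
          using step u by (simp add: w'_Suc)
        show "(h(w j \<mapsto> c (Suc j))) v = f v" if "v \<notin> w' ` {..<Suc j}" for v
        proof -
          have "v \<notin> w ` {..j}" using that image by (simp add: lessThan_Suc_atMost)
          then have "v \<noteq> w j" "v \<notin> w ` {..<j}" by auto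
          then show ?thesis using P_h(1)[OF P] by simp
        qed
        show "(h(w j \<mapsto> c (Suc j))) (w' i) = Some (c (Suc i))" if "i < Suc j" for i
        proof (cases "i = j")
          case False
          then have "w i \<noteq> w j" using inj_onD[OF P_inj[OF P], of i j] that by auto
          then show ?thesis using False P_h(2)[OF P, of i] that w' by simp
        qed (use w' in simp)
      qed
      then show ?thesis by blast
    qed
  qed
  from this[of "length V + 1"] have "\<exists>w h. P (length V + 1) w h" by simp
  then obtain w h where "P (length V + 1) w h" by blast
  from len[OF this] show False by simp
qed


lemma fails_ConsD:
  "fails (a # w) f x \<Longrightarrow> G x u \<Longrightarrow> f u = Some a \<Longrightarrow> fails w (f(x \<mapsto> a)) u"
  by simp

text \<open>Brooks' argument. Exchanging the colors of \<open>y\<close> and \<open>y'\<close>, which the token does by going round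
  the triangle, leaves the Kempe chain from \<open>y\<close> to \<open>z\<close> intact up to its second vertex \<open>v\<close>.
  If the token enters the chain at \<open>z\<close> and arrives at \<open>v\<close>, it sees the new color of \<open>y\<close> twice.\<close>

lemma not_all_walks_fail:
  assumes "proper f {x}" and fails: "\<And>w. w \<in> set walks \<Longrightarrow> fails w f x"
    and G: "G x y" "G x y'" "G x z" "G y y'" and "\<not> G y z" and "y \<noteq> z" and "0 < D"
  shows False
proof -
  have D: "0 < D" by fact
  from fails[OF walks_memI[OF D D D D]] have st: "stuck f x" by simp
  obtain a where a: "a < D" "f y = Some a" using stuck_colored[OF st G(1)] .
  obtain e where e: "e < D" "f y' = Some e" using stuck_colored[OF st G(2)] .
  obtain b where b: "b < D" "f z = Some b" using stuck_colored[OF st G(3)] .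
  have neq: "x \<noteq> y" "x \<noteq> y'" "x \<noteq> z" "y \<noteq> y'" "y' \<noteq> z"
    using G \<open>\<not> G y z\<close> irrefl by metis+
  have "a \<noteq> e" using stuck_unique[OF st G(1,2)] a e neq by auto
  have "a \<noteq> b" using stuck_unique[OF st G(1,3)] a b \<open>y \<noteq> z\<close> by auto
  have "b \<noteq> e" using stuck_unique[OF st G(2,3)] b e neq by auto
  \<comment> \<open>The first two letters take the token to \<open>y\<close> and back. Their only
    trace is the entry of \<open>x\<close>, which does not count while the token is there; the other
    letters follow the Kempe chain of \<open>x\<close> in the colors \<open>a\<close> and
    \<open>b\<close>.\<close>
  have "fails ([a, a, a] @ zigzag b a) f x" by (rule fails[OF walks_memI]) (use a b in simp_all)
  then have "fails (a # a # zigzag b a) (f(x \<mapsto> a)) y"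
    using fails_ConsD[of a "a # a # zigzag b a" f x y] G a by simp
  then have "fails (a # zigzag b a) (f(x \<mapsto> a, y \<mapsto> a)) x"
    using fails_ConsD[of a "a # zigzag b a" "f(x \<mapsto> a)" y x] sym[OF G(1)] by simp
  moreover have "f(y \<mapsto> a) = f" using a by auto
  then have "f(x \<mapsto> a, y \<mapsto> a) = f(x \<mapsto> a)" using neq by (metis fun_upd_twist)
  ultimately have "fails (a # zigzag b a) (f(x \<mapsto> a)) x" by simp
  moreover have "proper (f(x \<mapsto> a)) {x}" using assms(1) by (simp add: proper_def)
  ultimately obtain w L where w: "w 0 = x" "inj_on w {..L}" "\<And>i. i < L \<Longrightarrow> G (w i) (w (Suc i))"
    and wf: "\<And>i. 1 \<le> i \<Longrightarrow> i \<le> L \<Longrightarrow> (f(x \<mapsto> a)) (w i) = Some (if odd i then a else b)"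
    and L: "even L" "2 \<le> L" "L \<le> length V" and wL: "G (w L) x"
    using kempe_cycle[OF _ \<open>a \<noteq> b\<close> a(1) b(1), of "f(x \<mapsto> a)" x] by metis
  have w_eq: "w i = w j \<longleftrightarrow> i = j" if "i \<le> L" "j \<le> L" for i j
    using w(2) that by (auto dest: inj_onD)
  have w_x: "w i \<noteq> x" if "1 \<le> i" "i \<le> L" for i
    using w_eq[of i 0] that w(1) by auto
  have wf: "f (w i) = Some (if odd i then a else b)" if "1 \<le> i" "i \<le> L" for i
    using wf[OF that] w_x[OF that] by simp
  \<comment> \<open>Neighbors of a stuck vertex are determined by their colors: the cycle leaves
    \<open>x\<close> through \<open>y\<close>, which has color \<open>a\<close>, and returns through
    \<open>z\<close>, which has color \<open>b\<close>.\<close>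
  have w1: "w 1 = y"
    by (rule stuck_unique[OF st _ G(1)]) (use w(3)[of 0] w(1) wf[of 1] L a in auto)
  have wz: "w L = z"
    by (rule stuck_unique[OF st sym[OF wL] G(3)]) (use wf[of L] L b in auto)
  define v where "v = w 2"
  have yv: "G y v" using w(3)[of 1] w1 L by (simp add: v_def numeral_2_eq_2)
  then have "L \<noteq> 2" using \<open>\<not> G y z\<close> wz by (auto simp: v_def)
  have fv: "f v = Some b" using wf[of 2] L by (simp add: v_def)
  have v_x: "v \<noteq> x" using w_x[of 2] L by (simp add: v_def)
  have v_y: "v \<noteq> y" using yv irrefl by blast
  have v_y': "v \<noteq> y'" using fv e \<open>b \<noteq> e\<close> by auto
  have "\<not> G v x"
  proof
    assume "G v x"
    then have "v = z" using stuck_unique[OF st sym[of v x] G(3)] fv b by simp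
    then show False using w_eq[of 2 L] L \<open>L \<noteq> 2\<close> wz by (simp add: v_def)
  qed
  \<comment> \<open>The coloring after a trip round the triangle along \<open>a\<close>,
    \<open>e\<close>, \<open>a\<close>: the token is back at \<open>x\<close>, and \<open>y\<close>
    and \<open>y'\<close> have exchanged their colors.\<close>
  define g where "g = f(x \<mapsto> a, y \<mapsto> e, y' \<mapsto> a)"
  have g: "fails (zigzag b' d) g x" if "b' < D" "d < D" for b' d
  proof -
    have "fails ([a, e, a] @ zigzag b' d) f x" by (rule fails[OF walks_memI]) (use a e that in simp_all)
    then have "fails (e # a # zigzag b' d) (f(x \<mapsto> a)) y"
      using fails_ConsD[of a "e # a # zigzag b' d" f x y] G a by simp
    then have "fails (a # zigzag b' d) (f(x \<mapsto> a, y \<mapsto> e)) y'"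
      using fails_ConsD[of e "a # zigzag b' d" "f(x \<mapsto> a)" y y'] G e neq by simp
    then show ?thesis
      using fails_ConsD[of a "zigzag b' d" "f(x \<mapsto> a, y \<mapsto> e)" y' x] sym[OF G(2)] neq
      by (simp add: g_def)
  qed
  \<comment> \<open>From \<open>g\<close> the token moves along \<open>e\<close> to \<open>y\<close>
    and along \<open>b\<close> to \<open>v\<close>. Being stuck at \<open>v\<close>, it sees the
    color \<open>e\<close>; but \<open>y\<close> has just received \<open>b\<close>, and
    \<open>x\<close> is not adjacent to \<open>v\<close>. So \<open>v\<close> has a neighbor other
    than \<open>y\<close> with color \<open>e\<close>.\<close>
  have "\<exists>q. G v q \<and> q \<noteq> y \<and> g q = Some e"
  proof -
    have "2 \<le> length V" "V \<noteq> []" using order.trans[OF L(2,3)] by auto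
    then have "[0..<2 * length V] = 0 # 1 # 2 # [Suc 2..<2 * length V]"
      using upt_conv_Cons[of 0 "2 * length V"] upt_conv_Cons[of 1 "2 * length V"]
        upt_conv_Cons[of 2 "2 * length V"] by (auto simp: numeral_2_eq_2 simp del: upt_Suc)
    then have "zigzag e b = e # b # e # map (\<lambda>i. if even i then e else b) [Suc 2..<2 * length V]"
      by (simp add: zigzag_eq del: upt_Suc)
    with g[OF e(1) b(1)] obtain r where "fails (e # b # e # r) g x" by auto
    then have "fails (b # e # r) (g(x \<mapsto> e)) y"
      using fails_ConsD[of e "b # e # r" g x y] G neq by (simp add: g_def)
    then have "fails (e # r) (g(x \<mapsto> e, y \<mapsto> b)) v"
      using fails_ConsD[of b "e # r" "g(x \<mapsto> e)" y v] yv fv v_x v_y v_y' by (simp add: g_def)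
    then obtain q where "G v q" "(g(x \<mapsto> e, y \<mapsto> b)) q = Some e"
      using e(1) by (auto simp: stuck_def)
    then show ?thesis using \<open>\<not> G v x\<close> \<open>b \<noteq> e\<close> by (auto split: if_splits)
  qed
  then obtain q where q: "G v q" "q \<noteq> y" "g q = Some e" by blast
  let ?c = "\<lambda>i. if even i then b else a"
  \<comment> \<open>Now the chain is traversed from its far end. After \<open>i\<close> moves the
    token is at \<open>w (L + 1 - i)\<close>, and apart from \<open>x\<close> only the vertices
    passed may differ from \<open>g\<close>. The vertices from \<open>w 2\<close> on are not
    affected by the exchange: they are not \<open>x\<close> or \<open>y\<close>, and
    \<open>y'\<close> has the color \<open>e\<close>, which does not occur on the chain. At
    \<open>i = L - 1\<close> the token arrives at \<open>v\<close>.\<close>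
  have "\<exists>h. fails (map ?c [i..<2 * length V]) h (w (Suc L - i)) \<and>
      (\<forall>u. u \<noteq> x \<longrightarrow> u \<notin> w ` {Suc L - i<..L} \<longrightarrow> h u = g u)" if "1 \<le> i" "i < L" for i
    using that
  proof (induction i rule: dec_induct)
    case base
    have "fails (map ?c [0..<2 * length V]) g x"
      using g[OF b(1) a(1)] by (simp add: zigzag_eq)
    moreover have "[0..<2 * length V] = 0 # [1..<2 * length V]"
      unfolding One_nat_def by (rule upt_conv_Cons) (use L in linarith)
    ultimately have "fails (b # map ?c [1..<2 * length V]) g x" by simp
    moreover have "g z = Some b" using b neq \<open>y \<noteq> z\<close> by (simp add: g_def)
    ultimately have "fails (map ?c [1..<2 * length V]) (g(x \<mapsto> b)) z"
      using G(3) fails_ConsD by blast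
    then have "fails (map ?c [1..<2 * length V]) (g(x \<mapsto> b)) (w (Suc L - 1)) \<and>
        (\<forall>u. u \<noteq> x \<longrightarrow> u \<notin> w ` {Suc L - 1<..L} \<longrightarrow> (g(x \<mapsto> b)) u = g u)"
      using wz by simp
    then show ?case by blast
  next
    case (step i)
    then obtain h where h: "fails (map ?c [i..<2 * length V]) h (w (Suc L - i))"
      "\<And>u. u \<noteq> x \<Longrightarrow> u \<notin> w ` {Suc L - i<..L} \<Longrightarrow> h u = g u" by auto
    have "[i..<2 * length V] = i # [Suc i..<2 * length V]"
      using L step by (simp add: upt_conv_Cons)
    with h(1) have h1: "fails (?c i # map ?c [Suc i..<2 * length V]) h (w (Suc L - i))" by simp
    have Suc_L: "Suc L - i = Suc (L - i)" "2 \<le> L - i" using step by auto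
    have adj: "G (w (Suc L - i)) (w (L - i))"
      using sym[OF w(3)[of "L - i"]] step Suc_L by simp
    have col: "f (w (L - i)) = Some (?c i)"
      using wf[of "L - i"] Suc_L L step by auto
    have "w (L - i) \<noteq> x" "w (L - i) \<noteq> y" "w (L - i) \<noteq> y'"
      using w_x[of "L - i"] w_eq[of "L - i" 1] w1 Suc_L col e \<open>a \<noteq> e\<close> \<open>b \<noteq> e\<close> by (auto split: if_splits)
    moreover have "w (L - i) \<notin> w ` {Suc L - i<..L}"
    proof
      assume "w (L - i) \<in> w ` {Suc L - i<..L}"
      then obtain j where "Suc L - i < j" "j \<le> L" "w (L - i) = w j" by auto
      then show False using w_eq[of "L - i" j] by auto
    qed
    ultimately have "h (w (L - i)) = Some (?c i)" using h(2) col by (simp add: g_def)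
    then have "fails (map ?c [Suc i..<2 * length V]) (h(w (Suc L - i) \<mapsto> ?c i)) (w (Suc L - Suc i))"
      using fails_ConsD[OF h1 adj] by simp
    moreover have "(h(w (Suc L - i) \<mapsto> ?c i)) u = g u"
      if "u \<noteq> x" "u \<notin> w ` {Suc L - Suc i<..L}" for u
    proof -
      have "{Suc L - Suc i<..L} = insert (Suc L - i) {Suc L - i<..L}" using step by auto
      then show ?thesis using that h(2)[of u] by simp
    qed
    ultimately show ?case by blast
  qed
  note backwards = this
  have "1 \<le> L - 1" "L - 1 < L" "Suc L - (L - 1) = 2" using L by auto
  with backwards[of "L - 1"] obtain h where h: "fails (map ?c [L - 1..<2 * length V]) h v"
    "\<And>u. u \<noteq> x \<Longrightarrow> u \<notin> w ` {2<..L} \<Longrightarrow> h u = g u"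
    unfolding v_def by auto
  have "[L - 1..<2 * length V] = (L - 1) # [Suc (L - 1)..<2 * length V]"
    using L by (intro upt_conv_Cons) auto
  with h(1) have "stuck h v" by simp
  moreover have "h y = Some e"
  proof -
    have "y \<notin> w ` {2<..L}"
    proof
      assume "y \<in> w ` {2<..L}"
      then obtain j where "2 < j" "j \<le> L" "y = w j" by auto
      then show False using w_eq[of 1 j] w1 by auto
    qed
    then show ?thesis using h(2) neq by (simp add: g_def)
  qed
  moreover have "h q = Some e"
  proof -
    have "q \<noteq> x" using q(1) \<open>\<not> G v x\<close> by auto
    moreover have "q \<notin> w ` {2<..L}"
    proof
      assume "q \<in> w ` {2<..L}"
      then obtain j where j: "2 < j" "j \<le> L" "q = w j" by auto
      have "q \<noteq> y'" using q(3) \<open>a \<noteq> e\<close> by (auto simp: g_def)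
      then have "f q = Some e" using q \<open>q \<noteq> x\<close> by (simp add: g_def)
      then show False using wf[of j] j \<open>a \<noteq> e\<close> \<open>b \<noteq> e\<close> by (auto split: if_splits)
    qed
    ultimately show ?thesis using h(2) q(3) by simp
  qed
  ultimately have "y = q" using stuck_unique[OF _ sym[OF yv] q(1)] by simp
  then show False using q(2) by simp
qed

text \<open>A stuck token has \<open>D\<close> neighbors, and a single move takes it to any neighbor
  of \<open>x\<close>, where it is stuck again.\<close>

lemma nbrs_full_degree:
  assumes "\<And>w. w \<in> set walks \<Longrightarrow> fails w f x" and "G x y"
  shows "card {v. G x v} = D" and "card {v. G y v} = D"
proof -
  have "0 < D"
    using assms(2) degree[of x] finite_nbrs[of x] by (metis card_gt_0_iff empty_iff le_zero_eq mem_Collect_eq not_gr0)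
  then have "stuck f x" using assms(1)[OF walks_memI[of 0 0 0 0]] by simp
  then show "card {v. G x v} = D" by (rule stuck_bij)
  obtain a where a: "a < D" "f y = Some a" using stuck_colored[OF \<open>stuck f x\<close> assms(2)] .
  have "fails ([a, a, a] @ zigzag a a) f x" using assms(1)[OF walks_memI] a by blast
  then have "fails (a # a # zigzag a a) (f(x \<mapsto> a)) y"
    using fails_ConsD[of a "a # a # zigzag a a" f x y] assms(2) a by simp
  then have "stuck (f(x \<mapsto> a)) y" by simp
  then show "card {v. G y v} = D" by (rule stuck_bij)
qed

end

section \<open>Brooks' argument for unions of clique-like graphs\<close>

text \<open>Here \<open>A i\<close> is the graph coming from the \<open>i\<close>-th matroid. The last assumption is a local form of:
  components of \<open>A i\<close> that are regular of degree \<open>k - 1\<close> are cliques.\<close>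

locale clique_like_graph = bounded_graph +
  fixes k :: nat and A :: "nat \<Rightarrow> 'a \<Rightarrow> 'a \<Rightarrow> bool"
  assumes k: "2 \<le> k" and D_eq: "D = k * (k - 1)"
    and G_iff: "G u v \<longleftrightarrow> (\<exists>i < k. A i u v)"
    and A_sym: "A i u v \<Longrightarrow> A i v u"
    and A_degree: "i < k \<Longrightarrow> card {v. A i u v} \<le> k - 1"
    and A_trans: "i < k \<Longrightarrow> A i u x \<Longrightarrow> A i x v \<Longrightarrow> u \<noteq> v \<Longrightarrow> card {w. A i u w} = k - 1 \<Longrightarrow>
          card {w. A i v w} = k - 1 \<Longrightarrow> A i u v"
begin

lemma A_finite: "i < k \<Longrightarrow> finite {v. A i u v}"
  by (rule finite_subset[OF _ finite_nbrs[of u]]) (auto simp: G_iff)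

text \<open>The \<open>k\<close> neighborhoods of size at most \<open>k - 1\<close> cover
  \<open>k (k - 1)\<close> vertices, so each has full size and no two of them overlap.\<close>

lemma full_degree:
  assumes "card {v. G u v} = D" and "i < k"
  shows "card {v. A i u v} = k - 1" and "A i u v \<Longrightarrow> A j u v \<Longrightarrow> j < k \<Longrightarrow> i = j"
proof -
  have un: "{v. G u v} = (\<Union>i<k. {v. A i u v})" by (auto simp: G_iff)
  have le: "card {v. G u v} \<le> (\<Sum>i<k. card {v. A i u v})"
    unfolding un by (rule card_UN_le) simp
  show 1: "card {v. A i u v} = k - 1"
  proof (rule ccontr)
    assume "card {v. A i u v} \<noteq> k - 1"
    then have "card {v. A i u v} < k - 1" using A_degree[OF assms(2), of u] by simp
    then have "(\<Sum>i<k. card {v. A i u v}) < (\<Sum>i<k. k - 1)"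
      using A_degree assms(2) by (intro sum_strict_mono_ex1) auto
    then show False using le assms(1) D_eq by simp
  qed
  show "i = j" if v: "A i u v" "A j u v" "j < k"
  proof (rule ccontr)
    assume "i \<noteq> j"
    \<comment> \<open>The common neighbor \<open>v\<close> is already counted in the graph with
      index \<open>j\<close>, so it can be removed from that with index \<open>i\<close>.\<close>
    have "{v. G u v} = (\<Union>l\<in>{..<k} - {i}. {v. A l u v}) \<union> ({v. A i u v} - {v})"
      using v \<open>i \<noteq> j\<close> assms(2) by (auto simp: G_iff)
    then have "card {v. G u v} \<le> card (\<Union>l\<in>{..<k} - {i}. {v. A l u v}) + card ({v. A i u v} - {v})"
      by (metis card_Un_le)
    also have "card (\<Union>l\<in>{..<k} - {i}. {v. A l u v}) \<le> (\<Sum>l\<in>{..<k} - {i}. card {v. A l u v})"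
      by (rule card_UN_le) simp
    also have "\<dots> \<le> (\<Sum>l\<in>{..<k} - {i}. k - 1)" using A_degree by (intro sum_mono) auto
    also have "\<dots> = (k - 1) * (k - 1)" using assms(2) by simp
    also have "card ({v. A i u v} - {v}) < k - 1"
      using 1 v A_finite[OF assms(2), of u] k by (simp add: card_Diff_singleton_if)
    finally have "k * (k - 1) < (k - 1) * (k - 1) + (k - 1)" using assms(1) D_eq by linarith
    moreover have "k * (k - 1) = (k - 1) * (k - 1) + (k - 1)" using k by (cases k) auto
    ultimately show False by simp
  qed
qed

text \<open>Since \<open>k - 1\<close> is at least 2, \<open>x\<close> has two neighbors
  \<open>y\<close> and \<open>y'\<close> in graph 0, and these are adjacent. Suppose every neighbor
  \<open>z\<close> of \<open>x\<close> in graph 1 is joined to \<open>y\<close>, say in graph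
  \<open>t z\<close>. If \<open>t z\<close> were 0 or 1, transitivity would join \<open>x\<close> to
  \<open>z\<close> or to \<open>y\<close> in both graphs 0 and 1. If two such \<open>z\<close> had
  the same \<open>t z\<close>, they would be joined in this graph and in graph 1. So
  \<open>t\<close> would inject \<open>k - 1\<close> vertices into \<open>k - 2\<close>
  indices.\<close>

lemma obtain_configuration:
  assumes "3 \<le> k" and full: "card {v. G x v} = D"
    and full_nbr: "\<And>y. G x y \<Longrightarrow> card {v. G y v} = D"
  obtains y y' z where "G x y" "G x y'" "G x z" "G y y'" "\<not> G y z" "y \<noteq> z"
proof -
  have k3: "0 < k" "1 < k" using assms by auto
  have AG: "G u v" if "A i u v" "i < k" for i u v using that G_iff by blast
  have c0: "card {v. A 0 x v} = k - 1" and c1: "card {v. A 1 x v} = k - 1"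
    using full_degree(1)[OF full] k3 by blast+
  have "\<not> card {v. A 0 x v} \<le> Suc 0" using c0 assms(1) by simp
  then obtain y y' where y: "A 0 x y" "A 0 x y'" "y \<noteq> y'"
    using A_finite[OF k3(1), of x] by (auto simp: card_le_Suc0_iff_eq)
  note full_y = full_nbr[OF AG[OF y(1) k3(1)]] and full_y' = full_nbr[OF AG[OF y(2) k3(1)]]
  have yy': "A 0 y y'"
    by (rule A_trans[OF k3(1) A_sym[OF y(1)] y(2) y(3)])
      (use full_degree(1)[OF full_y k3(1)] full_degree(1)[OF full_y' k3(1)] in auto)
  have "\<exists>z. A 1 x z \<and> \<not> G y z"
  proof (rule ccontr)
    assume "\<nexists>z. A 1 x z \<and> \<not> G y z"
    then have "\<forall>z. \<exists>i. A 1 x z \<longrightarrow> i < k \<and> A i y z" by (auto simp: G_iff)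
    then obtain t where t: "\<And>z. A 1 x z \<Longrightarrow> t z < k" "\<And>z. A 1 x z \<Longrightarrow> A (t z) y z" by metis
    have full_z: "card {v. A i z v} = k - 1" "A i z u \<Longrightarrow> A j z u \<Longrightarrow> j < k \<Longrightarrow> i = j"
      if "A 1 x z" "i < k" for i j z u
      using full_degree[OF full_nbr[OF AG[OF that(1) k3(2)]] that(2)] by blast+
    have z_neq: "z \<noteq> x" "z \<noteq> y" if "A 1 x z" for z
    proof -
      show "z \<noteq> x" using that irrefl AG k3(2) by blast
      show "z \<noteq> y" using full_degree(2)[OF full k3(1) y(1) _ k3(2)] that by auto
    qed
    have "t z \<noteq> 0" if z: "A 1 x z" for z
    proof
      assume "t z = 0"
      then have "A 0 z y" using A_sym[OF t(2)[OF z]] by simp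
      then have "A 0 z x"
        by (rule A_trans[OF k3(1) _ A_sym[OF y(1)] z_neq(1)[OF z] full_z(1)[OF z k3(1)] c0])
      then show False using full_degree(2)[OF full k3(1) A_sym z k3(2)] by simp
    qed
    moreover have "t z \<noteq> 1" if z: "A 1 x z" for z
    proof
      assume "t z = 1"
      then have "A 1 y z" using t(2)[OF z] by simp
      then have "A 1 y x"
        by (rule A_trans[OF k3(2) _ A_sym[OF z] _ full_degree(1)[OF full_y k3(2)] c1])
          (use irrefl AG[OF y(1) k3(1)] in blast)
      then show False using full_degree(2)[OF full k3(1) y(1) A_sym k3(2)] by simp
    qed
    ultimately have "t ` {z. A 1 x z} \<subseteq> {2..<k}"
      using t(1) by (fastforce simp: image_subset_iff numeral_2_eq_2 Suc_le_eq)
    then have "card (t ` {z. A 1 x z}) \<le> k - 2"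
      using card_mono[of "{2..<k}"] by fastforce
    moreover have "inj_on t {z. A 1 x z}"
    proof (rule inj_onI, rule ccontr)
      fix z z' assume "z \<in> {z. A 1 x z}" "z' \<in> {z. A 1 x z}" and eq: "t z = t z'" and "z \<noteq> z'"
      then have z: "A 1 x z" "A 1 x z'" by auto
      have "A (t z) z z'"
        by (rule A_trans[OF t(1)[OF z(1)] A_sym[OF t(2)[OF z(1)]] _ \<open>z \<noteq> z'\<close>])
          (use t z eq full_z(1) in auto)
      moreover have "A 1 z z'"
        by (rule A_trans[OF k3(2) A_sym[OF z(1)] z(2) \<open>z \<noteq> z'\<close>]) (use z k3 full_z(1) in auto)
      ultimately have "t z = 1" using full_z(2)[OF z(1) t(1)[OF z(1)] _ _ k3(2)] by blast
      with \<open>\<And>z. A 1 x z \<Longrightarrow> t z \<noteq> 1\<close> z show False by blast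
    qed
    then have "card (t ` {z. A 1 x z}) = k - 1" using c1 by (simp add: card_image)
    ultimately show False using assms(1) by simp
  qed
  then obtain z where z: "A 1 x z" "\<not> G y z" by blast
  have "y \<noteq> z" using full_degree(2)[OF full k3(1) y(1) _ k3(2)] z(1) by auto
  with z that[of y y' z] y yy' AG k3 show thesis by blast
qed

text \<open>For \<open>k = 2\<close> the edges of a path alternate between two matchings, so that there are no odd
  cycles.\<close>

lemma some_walk_succeeds:
  assumes "proper f {x}"
  shows "\<exists>w \<in> set walks. \<not> fails w f x"
proof (rule ccontr)
  assume "\<not> (\<exists>w \<in> set walks. \<not> fails w f x)"
  then have fails: "fails w f x" if "w \<in> set walks" for w using that by blast
  have D: "0 < D" using k D_eq by simp
  have st: "stuck f x" using fails[OF walks_memI[OF D D D D]] by simp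
  show False
  proof (cases "k = 2")
    case False
    then have "3 \<le> k" using k by simp
    obtain y where "G x y" using st D by (auto simp: stuck_def)
    obtain y y' z where "G x y" "G x y'" "G x z" "G y y'" "\<not> G y z" "y \<noteq> z"
      by (rule obtain_configuration[OF \<open>3 \<le> k\<close> nbrs_full_degree(1)[OF fails \<open>G x y\<close>]
            nbrs_full_degree(2)[OF fails]]) auto
    with not_all_walks_fail[OF assms fails] D show False by blast
  next
    case True
    have D2: "D = 2" using True D_eq by simp
    have "fails ([0, 0, 0] @ zigzag 1 0) f x" by (rule fails[OF walks_memI]) (simp_all add: D2)
    obtain y where y: "G x y" "f y = Some 0" using st D by (auto simp: stuck_def)
    have "fails (0 # 0 # zigzag 1 0) (f(x \<mapsto> 0)) y"
      using fails_ConsD[of 0 "0 # 0 # zigzag 1 0" f x y] y \<open>fails ([0, 0, 0] @ zigzag 1 0) f x\<close> by simp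
    then have "fails (0 # zigzag 1 0) (f(x \<mapsto> 0, y \<mapsto> 0)) x"
      using fails_ConsD[of 0 "0 # zigzag 1 0" "f(x \<mapsto> 0)" y x] sym[OF y(1)] by simp
    moreover have "f(y \<mapsto> 0) = f" "x \<noteq> y" using y irrefl by auto
    then have "f(x \<mapsto> 0, y \<mapsto> 0) = f(x \<mapsto> 0)" by (metis fun_upd_twist)
    ultimately have *: "fails (0 # zigzag 1 0) (f(x \<mapsto> 0)) x" by simp
    have **: "proper (f(x \<mapsto> 0)) {x}" using assms by (simp add: proper_def)
    have "0 < D" "1 < D" using D2 by simp_all
    \<comment> \<open>As \<open>L\<close> is even, the cycle has an odd number \<open>L + 1\<close>
      of edges.\<close>
    obtain w L where w: "w 0 = x" "inj_on w {..L}" "\<And>i. i < L \<Longrightarrow> G (w i) (w (Suc i))"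
      and L: "even L" "2 \<le> L" and wL: "G (w L) x"
      using kempe_cycle[OF ** zero_neq_one \<open>0 < D\<close> \<open>1 < D\<close> *] by metis
    have AG: "G u v \<longleftrightarrow> A 0 u v \<or> A 1 u v" for u v
      using True by (auto simp: G_iff numeral_2_eq_2 less_Suc_eq)
    have unique: "v = v'" if "A i u v" "A i u v'" "i < 2" for i u v v'
      using A_degree[of i u] A_finite[of i u] that True by (auto simp: card_le_Suc0_iff_eq)
    obtain t where t: "t < 2" "A t (w 0) (w 1)" using w(3)[of 0] L AG by (metis One_nat_def one_less_numeral_iff pos2 less_le_trans semiring_norm(76))
    have alternate: "A ((t + i) mod 2) (w i) (w (Suc i))" if "i < L" for i
      using that
    proof (induction i)
      case 0
      then show ?case using t by simp
    next
      case (Suc i)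
      then have "A ((t + i) mod 2) (w (Suc i)) (w i)" using A_sym by simp
      moreover have "w i \<noteq> w (Suc (Suc i))" using w(2) Suc.prems by (auto dest: inj_onD)
      ultimately have "\<not> A ((t + i) mod 2) (w (Suc i)) (w (Suc (Suc i)))" using unique by force
      with w(3)[OF Suc.prems] AG show ?case
        by (cases "(t + i) mod 2 = 0") (auto simp: mod_Suc)
    qed
    obtain l where l: "L = Suc l" using L by (cases L) auto
    have "A ((t + l) mod 2) (w L) (w l)" using A_sym[OF alternate[of l]] l by simp
    moreover have "w l \<noteq> x" using inj_onD[OF w(2), of l 0] w(1) l L by auto
    ultimately have "\<not> A ((t + l) mod 2) (w L) x" using unique by force
    \<comment> \<open>Here \<open>l = L - 1\<close> is odd, so the last edge of the path lies in the
      other matching than the first. The closing edge then lies in the same matching as the first,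
      and both of them contain \<open>x\<close>.\<close>
    moreover have "(t + l) mod 2 \<noteq> t" using L l t by (auto simp: less_2_cases_iff)
    ultimately have "A t (w L) x"
      using wL AG t by (auto simp: less_2_cases_iff)
    then have "w L = w 1" using unique[OF A_sym] t w(1) by blast
    then show False using inj_onD[OF w(2), of L 1] L by auto
  qed
qed

section \<open>Correctness of the coloring\<close>

lemma insert_color_valid:
  assumes "proper (map_of f) {}"
  shows "proper (map_of (insert_color f x)) {} \<and>
         dom (map_of (insert_color f x)) = insert x (dom (map_of f))"
proof (cases "x \<in> set (map fst f)")
  case True
  then show ?thesis using assms by (auto simp: insert_color_def dom_map_of_conv_image_fst)
next
  case False
  let ?l = "filter (\<lambda>s. fst s = []) (map (\<lambda>w. foldl walk_step ([x], f) w) walks)"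
  have px: "proper (map_of f) {x}" using assms by (simp add: proper_def)
  obtain w where w: "w \<in> set walks" "\<not> fails w (map_of f) x"
    using some_walk_succeeds[OF px] by blast
  then have "fst (foldl walk_step ([x], f) w) = []"
    using fails_if_not_done walks_bounded by blast
  then have "foldl walk_step ([x], f) w \<in> set ?l" using w by auto
  then obtain s ss where s: "?l = s # ss" by (cases ?l) auto
  then have "s \<in> set ?l" by simp
  then obtain w' where w': "w' \<in> set walks" "s = foldl walk_step ([x], f) w'" "fst s = []" by auto
  have "valid_state (insert x (dom (map_of f))) ([x], f)"
    using px by (simp add: valid_state_def)
  then have "valid_state (insert x (dom (map_of f))) s"
    unfolding w'(2) using walks_bounded[OF w'(1)] by (rule valid_state_walk)
  moreover have "insert_color f x = snd s" using False s by (simp add: insert_color_def)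
  ultimately show ?thesis using w'(3) by (simp add: valid_state_def)
qed

lemma color_classes_correct:
  shows "length color_classes = D"
    and "\<Union>(set (map set color_classes)) = set V"
    and "X \<in> set color_classes \<Longrightarrow> u \<in> set X \<Longrightarrow> v \<in> set X \<Longrightarrow> \<not> G u v"
proof -
  have "proper (map_of (foldl insert_color f xs)) {} \<and>
      dom (map_of (foldl insert_color f xs)) = dom (map_of f) \<union> set xs"
    if "proper (map_of f) {}" for f xs
    using that by (induction xs arbitrary: f) (use insert_color_valid in auto)
  from this[of "[]" V] have p: "proper (map_of (foldl insert_color [] V)) {}"
    and d: "dom (map_of (foldl insert_color [] V)) = set V" by (auto simp: proper_def)
  show "length color_classes = D" by (simp add: color_classes_def)
  show "\<Union>(set (map set color_classes)) = set V"
  proof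
    show "set V \<subseteq> \<Union>(set (map set color_classes))"
    proof
      fix v assume "v \<in> set V"
      then obtain a where "map_of (foldl insert_color [] V) v = Some a" using d by auto
      with \<open>v \<in> set V\<close> p show "v \<in> \<Union>(set (map set color_classes))"
        by (auto simp: color_classes_def proper_def)
    qed
  qed (auto simp: color_classes_def)
  show "\<not> G u v" if "X \<in> set color_classes" "u \<in> set X" "v \<in> set X"
    using that p by (auto simp: color_classes_def proper_def)
qed

end

section \<open>From decompositions to graphs\<close>

text \<open>The test \<open>ind\<close> stands for an independence oracle.\<close>

definition greedy_basis :: "('a list \<Rightarrow> bool) \<Rightarrow> 'a list \<Rightarrow> 'a list" where
  "greedy_basis ind T = foldl (\<lambda>B x. if ind (x # B) then x # B else B) [] T"

definition excess :: "('a list \<Rightarrow> bool) \<Rightarrow> 'a list \<Rightarrow> 'a list" where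
  "excess ind T = filter (\<lambda>e. \<not> e \<in> set (greedy_basis ind T)) T"

text \<open>For a non-loop \<open>e\<close> outside the basis, a suitable \<open>b\<close> exists by
  basis exchange, so the default value \<open>e\<close> does not occur there.\<close>

definition partner :: "('a list \<Rightarrow> bool) \<Rightarrow> 'a list \<Rightarrow> 'a \<Rightarrow> 'a" where
  "partner ind T e =
     (case filter (\<lambda>b. ind (e # filter (\<lambda>v. \<not> v = b) (greedy_basis ind T))) (greedy_basis ind T) of
        [] \<Rightarrow> e | b # _ \<Rightarrow> b)"

text \<open>The list contains pairs \<open>(e, e)\<close> and may give an edge in one direction
  only; \<open>adjacent\<close> discards loops and symmetrizes.\<close>

definition block_edges :: "('a list \<Rightarrow> bool) \<Rightarrow> 'a list \<Rightarrow> ('a \<times> 'a) list" where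
  "block_edges ind T =
     concat (map (\<lambda>e. (e, partner ind T e) # map (\<lambda>e'. (e, e')) (excess ind T)) (excess ind T))"

definition adjacent :: "('a \<times> 'a) list \<Rightarrow> 'a \<Rightarrow> 'a \<Rightarrow> bool" where
  "adjacent es u v \<longleftrightarrow>
     \<not> u = v \<and> (\<exists>e \<in> set es. fst e = u \<and> snd e = v \<or> fst e = v \<and> snd e = u)"

lemma adjacent_iff: "adjacent es u v \<longleftrightarrow> u \<noteq> v \<and> ((u, v) \<in> set es \<or> (v, u) \<in> set es)"
  by (force simp: adjacent_def)

lemma adjacent_sym: "adjacent es u v \<Longrightarrow> adjacent es v u"
  by (auto simp: adjacent_iff)

lemma set_block_edges:
  "set (block_edges ind T) =
     {(e, partner ind T e) |e. e \<in> set (excess ind T)} \<union> set (excess ind T) \<times> set (excess ind T)"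
  by (auto simp: block_edges_def)

section \<open>Rank and exchange\<close>

context matroid
begin

lemma finite_indep: "X \<in> I \<Longrightarrow> finite X"
  using finite_ground indep_subset_ground finite_subset by blast

lemma rank_le:
  assumes "B \<in> I" and "\<And>x. x \<in> S - B \<Longrightarrow> insert x B \<notin> I"
  shows "rank_of I S \<le> card B"
proof -
  have "card X \<le> card B" if "X \<in> I" "X \<subseteq> S" for X
    using augment[OF assms(1) that(1)] assms(2) that(2) by (meson DiffD1 DiffD2 DiffI leI subsetD)
  moreover have "finite {card X |X. X \<in> I \<and> X \<subseteq> S}"
    by (rule finite_subset[of _ "card ` Pow U"]) (use finite_ground indep_subset_ground in auto)
  moreover have "{card X |X. X \<in> I \<and> X \<subseteq> S} \<noteq> {}" using empty_indep by auto
  ultimately show ?thesis unfolding rank_of_def by (subst Max_le_iff) auto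
qed

text \<open>Let \<open>Z\<close> be a largest independent set with
  \<open>e \<in> Z \<subseteq> insert e B\<close>. By augmentation from \<open>B\<close> it is at
  least as large as \<open>B\<close>, and it is not all of \<open>insert e B\<close>; so it omits
  exactly one element of \<open>B\<close>. This needs no theory of circuits.\<close>

lemma exchange:
  assumes "B \<in> I" and "e \<notin> B" and "{e} \<in> I" and "insert e B \<notin> I"
  obtains b where "b \<in> B" and "insert e (B - {b}) \<in> I"
proof -
  let ?F = "{Z \<in> I. e \<in> Z \<and> Z \<subseteq> insert e B}"
  have "\<exists>Z. Z \<in> ?F \<and> (\<forall>Y. Y \<in> ?F \<longrightarrow> card Y \<le> card Z)"
  proof (rule ex_has_greatest_nat)
    show "{e} \<in> ?F" using assms(3) by auto
    show "\<forall>Y. Y \<in> ?F \<longrightarrow> card Y < Suc (card (insert e B))"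
      using finite_indep[OF assms(1)] by (auto intro!: card_mono simp: less_Suc_eq_le)
  qed
  then obtain Z where Z: "Z \<in> ?F" and max: "\<And>Y. Y \<in> ?F \<Longrightarrow> card Y \<le> card Z" by blast
  have "finite Z" using Z finite_indep by auto
  have "card B \<le> card Z"
  proof (rule ccontr)
    assume "\<not> card B \<le> card Z"
    then obtain y where y: "y \<in> B - Z" "insert y Z \<in> I"
      using augment[of Z B] Z assms(1) by auto
    then have "insert y Z \<in> ?F" using Z by auto
    from max[OF this] y \<open>finite Z\<close> show False by simp
  qed
  have "Z \<noteq> insert e B" using Z assms(4) by auto
  then obtain b where b: "b \<in> B" "b \<notin> Z" using Z by blast
  have "Z \<subseteq> insert e (B - {b})" using Z b by auto
  moreover have "card (insert e (B - {b})) = Suc (card (B - {b}))"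
    using assms(2) finite_indep[OF assms(1)] by (intro card_insert_disjoint) auto
  then have "card (insert e (B - {b})) = card B"
    using card_Suc_Diff1[OF finite_indep[OF assms(1)] b(1)] by simp
  then have "card (insert e (B - {b})) \<le> card Z" using \<open>card B \<le> card Z\<close> by simp
  ultimately have "Z = insert e (B - {b})"
    using finite_indep[OF assms(1)] by (intro card_seteq) auto
  with Z b that show thesis by blast
qed

end

section \<open>The graph of one block\<close>

locale oracle_block = matroid U I for U :: "'a set" and I +
  fixes ind :: "'a list \<Rightarrow> bool" and T :: "'a list"
  assumes ind_iff: "ind X \<longleftrightarrow> set X \<in> I"
    and singleton_indep: "x \<in> set T \<Longrightarrow> {x} \<in> I"
begin

abbreviation "B \<equiv> set (greedy_basis ind T)"
abbreviation "E \<equiv> set (excess ind T)"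
abbreviation "p \<equiv> partner ind T"
abbreviation "H \<equiv> adjacent (block_edges ind T)"

lemma greedy_basis:
  shows "B \<in> I" and "B \<subseteq> set T" and "x \<in> set T - B \<Longrightarrow> insert x B \<notin> I"
proof -
  have "set B' \<in> I \<and> set B' \<subseteq> set S \<and> (\<forall>x \<in> set S - set B'. insert x (set B') \<notin> I)"
    if "B' = foldl (\<lambda>B x. if ind (x # B) then x # B else B) [] S" for S B'
    using that
  proof (induction S arbitrary: B' rule: rev_induct)
    case Nil
    then show ?case using empty_indep by simp
  next
    case (snoc y S)
    let ?B = "foldl (\<lambda>B x. if ind (x # B) then x # B else B) [] S"
    have IH: "set ?B \<in> I" "set ?B \<subseteq> set S" "\<And>x. x \<in> set S - set ?B \<Longrightarrow> insert x (set ?B) \<notin> I"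
      using snoc.IH[OF refl] by auto
    show ?case
    proof (cases "insert y (set ?B) \<in> I")
      case True
      then have B': "set B' = insert y (set ?B)" using snoc.prems by (simp add: ind_iff)
      have "insert x (set B') \<notin> I" if x: "x \<in> set (S @ [y]) - set B'" for x
      proof
        assume "insert x (set B') \<in> I"
        moreover have "insert x (set ?B) \<subseteq> insert x (set B')" using B' by auto
        ultimately have "insert x (set ?B) \<in> I" by (rule indep_subset)
        then show False using IH(3)[of x] x B' by auto
      qed
      then show ?thesis using True IH(2) by (auto simp: B')
    next
      case False
      then have "B' = ?B" using snoc.prems by (simp add: ind_iff)
      then show ?thesis using IH False by auto
    qed
  qed
  from this[OF refl, of T] show "B \<in> I" "B \<subseteq> set T" "x \<in> set T - B \<Longrightarrow> insert x B \<notin> I"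
    by (auto simp: greedy_basis_def)
qed

lemma set_excess: "E = set T - B"
  by (auto simp: excess_def)

lemma partner:
  assumes "e \<in> E"
  shows "p e \<in> B" and "insert e (B - {p e}) \<in> I"
proof -
  let ?l = "filter (\<lambda>b. ind (e # filter (\<lambda>v. \<not> v = b) (greedy_basis ind T))) (greedy_basis ind T)"
  have e: "e \<in> set T" "e \<notin> B" using assms by (auto simp: set_excess)
  have diff: "{v \<in> B. v \<noteq> b} = B - {b}" for b by auto
  obtain b where "b \<in> B" "insert e (B - {b}) \<in> I"
    using exchange[OF greedy_basis(1) e(2) singleton_indep[OF e(1)]] greedy_basis(3)[of e] e by blast
  then have "b \<in> set ?l" by (simp add: ind_iff diff)
  then obtain b' bs where l: "?l = b' # bs" by (cases ?l) auto
  then have "b' \<in> set ?l" by simp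
  then have "b' \<in> B" "insert e (B - {b'}) \<in> I" by (auto simp: ind_iff diff)
  moreover have "p e = b'" using l by (simp add: partner_def)
  ultimately show "p e \<in> B" "insert e (B - {p e}) \<in> I" by simp_all
qed

lemma H_iff: "H u v \<longleftrightarrow> u \<noteq> v \<and> (u \<in> E \<and> v \<in> E \<or> u \<in> E \<and> v = p u \<or> v \<in> E \<and> u = p v)"
  by (auto simp: adjacent_iff set_block_edges)

lemma H_in_block: "H u v \<Longrightarrow> u \<in> set T \<and> v \<in> set T"
  using partner(1) greedy_basis(2) by (auto simp: H_iff set_excess)

text \<open>A basis attains the rank, so the excess is the defect of the block, which flexibility
  bounds by \<open>k - 1\<close>.\<close>

lemma card_excess_le: "card (set T) \<le> rank_of I (set T) + m \<Longrightarrow> card E \<le> m"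
  using rank_le[OF greedy_basis(1), of "set T"] greedy_basis(2,3)
    card_Diff_subset[of B "set T"] by (simp add: set_excess)

lemma H_basis_nbrs: "u \<in> B \<Longrightarrow> {v. H u v} = {v \<in> E. p v = u}"
  using partner(1) by (auto simp: H_iff set_excess)

text \<open>An element of \<open>E\<close> is joined to the others in \<open>E\<close> and, in
  exchange for itself, to its partner; a basis element has neighbors in \<open>E\<close>
  only.\<close>

lemma H_degree: "card {v. H u v} \<le> card E"
proof (cases "u \<in> E")
  case True
  then have "{v. H u v} \<subseteq> insert (p u) (E - {u})"
    using partner(1)[of u] by (auto simp: H_iff)
  then have "card {v. H u v} \<le> card (insert (p u) (E - {u}))" by (intro card_mono) auto
  also have "\<dots> \<le> Suc (card (E - {u}))" by (simp add: card_insert_if)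
  also have "\<dots> = card E" using True by (intro card_Suc_Diff1) auto
  finally show ?thesis .
next
  case False
  then have "{v. H u v} \<subseteq> E" by (auto simp: H_iff)
  then show ?thesis by (intro card_mono) auto
qed

text \<open>A basis element of full degree is the partner of all elements of \<open>E\<close>. As
  \<open>E\<close> is not empty, there is at most one such basis element, and it is adjacent to all
  of the clique \<open>E\<close>.\<close>

lemma H_trans:
  assumes "card E \<le> m" and "0 < m" and "H u x" and "H x v" and "u \<noteq> v"
    and full: "card {w. H u w} = m" "card {w. H v w} = m"
  shows "H u v"
proof -
  have basis: "\<forall>e \<in> E. p e = w" if "w \<in> B" "card {v. H w v} = m" for w
  proof -
    have "{v \<in> E. p v = w} = E"
      using that assms(1) by (intro card_seteq) (auto simp: H_basis_nbrs)
    then show ?thesis by auto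
  qed
  have T: "u \<in> B \<or> u \<in> E" "v \<in> B \<or> v \<in> E"
    using H_in_block assms(3,4) by (auto simp: set_excess)
  have "E \<noteq> {}" using H_degree[of u] full assms(2) by auto
  then show ?thesis using T basis[of u] basis[of v] full \<open>u \<noteq> v\<close> by (auto simp: H_iff)
qed

text \<open>A stable set has at most one element \<open>e\<close> in \<open>E\<close>, and with
  \<open>e\<close> it cannot contain \<open>p e\<close>; so it is part of \<open>B\<close> or of
  \<open>B - {p e}\<close> together with \<open>e\<close>.\<close>

lemma stable_indep:
  assumes "S \<subseteq> set T" and stable: "\<And>u v. u \<in> S \<Longrightarrow> v \<in> S \<Longrightarrow> \<not> H u v"
  shows "S \<in> I"
proof (cases "S \<inter> E = {}")
  case True
  then have "S \<subseteq> B" using assms(1) by (auto simp: set_excess)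
  then show ?thesis by (rule indep_subset[OF greedy_basis(1)])
next
  case False
  then obtain e where e: "e \<in> S" "e \<in> E" by auto
  have "p e \<notin> S" using stable[OF e(1), of "p e"] partner(1)[OF e(2)] e(2) by (auto simp: H_iff set_excess)
  moreover have "v = e" if "v \<in> S" "v \<in> E" for v using stable[OF e(1) that(1)] e that by (auto simp: H_iff)
  ultimately have "S \<subseteq> insert e (B - {p e})" using assms(1) by (auto simp: set_excess)
  then show ?thesis by (rule indep_subset[OF partner(2)[OF e(2)]])
qed

end

section \<open>The graph of one matroid on a class\<close>

locale oracle_decomposition = matroid U I for U :: "'a set" and I +
  fixes ind :: "'a list \<Rightarrow> bool" and Ts :: "'a list list" and R :: "'a set" and k :: nat
  assumes ind_iff: "ind X \<longleftrightarrow> set X \<in> I"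
    and loopless: "loopless U I"
    and flexible: "flexible_decomposition k I R (map set Ts)"
    and R: "R \<subseteq> U"
    and k: "2 \<le> k"
begin

abbreviation "H \<equiv> adjacent (concat (map (block_edges ind) Ts))"

lemma blocks_union: "\<Union>(set ` set Ts) = R"
  using flexible by (simp add: flexible_decomposition_def partitions_def)

lemma block_unique:
  assumes "T \<in> set Ts" and "T' \<in> set Ts" and "x \<in> set T" and "x \<in> set T'"
  shows "T = T'"
proof -
  obtain i j where ij: "i < length Ts" "T = Ts ! i" "j < length Ts" "T' = Ts ! j"
    using assms(1,2) by (auto simp: in_set_conv_nth)
  have "i \<noteq> j \<Longrightarrow> set (Ts ! i) \<inter> set (Ts ! j) = {}"
    using flexible ij unfolding flexible_decomposition_def partitions_def by simp
  then show ?thesis using assms(3,4) ij by auto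
qed

lemma oracle_block: "T \<in> set Ts \<Longrightarrow> oracle_block U I ind T"
  by unfold_locales (use ind_iff loopless blocks_union R in \<open>auto simp: loopless_def\<close>)

lemma H_iff: "H u v \<longleftrightarrow> (\<exists>T \<in> set Ts. adjacent (block_edges ind T) u v)"
  by (auto simp: adjacent_iff)

lemma H_block:
  assumes "T \<in> set Ts" and "u \<in> set T"
  shows "H u v \<longleftrightarrow> adjacent (block_edges ind T) u v"
proof
  assume "H u v"
  then obtain T' where T': "T' \<in> set Ts" "adjacent (block_edges ind T') u v" by (auto simp: H_iff)
  then have "u \<in> set T'" using oracle_block.H_in_block[OF oracle_block] by blast
  then have "T' = T" using block_unique[OF T'(1) assms(1)] assms(2) by simp
  with T' show "adjacent (block_edges ind T) u v" by simp
qed (use assms H_iff in blast)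

lemma obtain_block:
  assumes "H u v"
  obtains T where "T \<in> set Ts" and "u \<in> set T" and "v \<in> set T"
proof -
  obtain T where "T \<in> set Ts" "adjacent (block_edges ind T) u v" using assms by (auto simp: H_iff)
  then show thesis using that oracle_block.H_in_block[OF oracle_block] by blast
qed

lemma H_in_R: "H u v \<Longrightarrow> v \<in> R"
  using blocks_union by (blast elim: obtain_block)

lemma card_excess:
  assumes "T \<in> set Ts"
  shows "card (set (excess ind T)) \<le> k - 1"
proof (rule oracle_block.card_excess_le[OF oracle_block[OF assms]])
  obtain j where "j < length Ts" "T = Ts ! j" using assms by (auto simp: in_set_conv_nth)
  then show "card (set T) \<le> rank_of I (set T) + (k - 1)"
    using flexible k by (fastforce simp: flexible_decomposition_def)
qed

lemma degree: "card {v. H u v} \<le> k - 1"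
proof (cases "\<exists>v. H u v")
  case True
  then obtain T where T: "T \<in> set Ts" "u \<in> set T" by (auto elim: obtain_block)
  then show ?thesis
    using oracle_block.H_degree[OF oracle_block[OF T(1)], of u] card_excess[OF T(1)] H_block[OF T]
    by simp
qed simp

lemma trans:
  assumes "H u x" and "H x v" and "u \<noteq> v" and "card {w. H u w} = k - 1" and "card {w. H v w} = k - 1"
  shows "H u v"
proof -
  obtain T where T: "T \<in> set Ts" "u \<in> set T" "x \<in> set T" using assms(1) by (rule obtain_block)
  obtain T' where T': "T' \<in> set Ts" "x \<in> set T'" "v \<in> set T'" using assms(2) by (rule obtain_block)
  have "T' = T" using block_unique[OF T'(1) T(1) T'(2) T(3)] .
  with T' have v: "v \<in> set T" by simp
  show ?thesis
    using oracle_block.H_trans[OF oracle_block[OF T(1)] card_excess[OF T(1)], of u x v] assms k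
    by (simp add: H_block[OF T(1,2)] H_block[OF T(1,3)] H_block[OF T(1) v])
qed

lemma stable_indep:
  assumes "S \<subseteq> R" and "\<And>u v. u \<in> S \<Longrightarrow> v \<in> S \<Longrightarrow> \<not> H u v"
  shows "S \<in> I"
proof -
  have "S \<inter> set (Ts ! j) \<in> I" if "j < length Ts" for j
    by (rule oracle_block.stable_indep[OF oracle_block[OF nth_mem[OF that]]])
      (use assms(2) nth_mem[OF that] H_iff in auto)
  then have "(\<Union>j < length Ts. S \<inter> set (Ts ! j)) \<in> I"
    using flexible[unfolded flexible_decomposition_def, THEN conjunct2, THEN conjunct2, rule_format,
        of "\<lambda>j. S \<inter> set (Ts ! j)"] by simp
  moreover have "(\<Union>j < length Ts. S \<inter> set (Ts ! j)) = S"
    using assms(1) blocks_union by (fastforce simp: in_set_conv_nth)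
  ultimately show ?thesis by simp
qed

end

section \<open>The coloring program\<close>

text \<open>A program with several arguments is analysed once, on tuples; the lifting rules then
  allow it to be applied to computed arguments.\<close>

lemma polytime_lift2:
  assumes "polytime UNIV (eprod E1 E2) F (\<lambda>ask p. g ask (fst p) (snd p))"
    and "polytime A E E1 f1" and "polytime A E E2 f2"
  shows "polytime A E F (\<lambda>ask x. g ask (f1 ask x) (f2 ask x))"
  using polytime_comp[OF polytime_Pair[OF assms(2,3)] assms(1)] by simp

lemma polytime_lift3:
  assumes "polytime UNIV (eprod E1 (eprod E2 E3)) F (\<lambda>ask p. g ask (fst p) (fst (snd p)) (snd (snd p)))"
    and "polytime A E E1 f1" and "polytime A E E2 f2" and "polytime A E E3 f3"
  shows "polytime A E F (\<lambda>ask x. g ask (f1 ask x) (f2 ask x) (f3 ask x))"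
  using polytime_comp[OF polytime_Pair[OF assms(2) polytime_Pair[OF assms(3,4)]] assms(1)] by simp

lemma polytime_lift5:
  assumes "polytime UNIV (eprod E1 (eprod E2 (eprod E3 (eprod E4 E5)))) F
      (\<lambda>ask p. g ask (fst p) (fst (snd p)) (fst (snd (snd p))) (fst (snd (snd (snd p))))
         (snd (snd (snd (snd p)))))"
    and "polytime A E E1 f1" and "polytime A E E2 f2" and "polytime A E E3 f3"
    and "polytime A E E4 f4" and "polytime A E E5 f5"
  shows "polytime A E F (\<lambda>ask x. g ask (f1 ask x) (f2 ask x) (f3 ask x) (f4 ask x) (f5 ask x))"
  using polytime_comp[OF polytime_Pair[OF assms(2) polytime_Pair[OF assms(3)
        polytime_Pair[OF assms(4) polytime_Pair[OF assms(5,6)]]]] assms(1)] by simp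

lemma polytime_null [polytime_intros]:
  assumes "polytime A E (elist F) l"
  shows "polytime A E dbool (\<lambda>ask x. l ask x = [])"
proof -
  have "polytime A E dbool (\<lambda>ask x. case l ask x of [] \<Rightarrow> True | y # ys \<Rightarrow> False)"
    by (rule polytime_case_list[OF assms]) (rule polytime_intros)+
  then show ?thesis by (rule polytime_cong) (simp split: list.split)
qed

section \<open>Running time and growth of the walks\<close>

abbreviation eedges :: "('a \<times> 'a) list \<Rightarrow> 'a data" where
  "eedges \<equiv> elist (eprod DAtom DAtom)"

abbreviation ecolors :: "('a \<times> nat) list \<Rightarrow> 'a data" where
  "ecolors \<equiv> elist (eprod DAtom dnat)"

abbreviation estate :: "'a list \<times> ('a \<times> nat) list \<Rightarrow> 'a data" where
  "estate \<equiv> eprod (elist DAtom) ecolors"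

text \<open>Expresses lookup by a filter and a case distinction, for which programs are at
  hand.\<close>

lemma map_of_eq_Some_iff_filter:
  "map_of f v = Some a \<longleftrightarrow>
     (case filter (\<lambda>p. fst p = v) f of [] \<Rightarrow> False | p # ps \<Rightarrow> snd p = a)"
  by (induction f) auto

lemma polytime_map_of [polytime_intros]:
  assumes "polytime A E ecolors f" and "polytime A E DAtom v" and "polytime A E dnat a"
  shows "polytime A E dbool (\<lambda>ask x. map_of (f ask x) (v ask x) = Some (a ask x))"
proof -
  have "polytime UNIV (eprod ecolors (eprod DAtom dnat)) dbool
      (\<lambda>ask p. map_of (fst p) (fst (snd p)) = Some (snd (snd p)))"
    unfolding map_of_eq_Some_iff_filter by (rule polytime_intros)+
  from polytime_lift3[where g = "\<lambda>ask f v a. map_of f v = Some a", OF this assms] show ?thesis .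
qed

lemma polytime_adjacent [polytime_intros]:
  assumes "polytime A E eedges es" and "polytime A E DAtom u" and "polytime A E DAtom v"
  shows "polytime A E dbool (\<lambda>ask x. adjacent (es ask x) (u ask x) (v ask x))"
proof -
  have "polytime UNIV (eprod eedges (eprod DAtom DAtom)) dbool
      (\<lambda>ask p. adjacent (fst p) (fst (snd p)) (snd (snd p)))"
    unfolding adjacent_def by (rule polytime_intros)+
  from polytime_lift3[where g = "\<lambda>ask. adjacent", OF this assms] show ?thesis .
qed

lemma polytime_available0:
  "polytime UNIV (eprod eedges (eprod (elist DAtom) (eprod dnat (eprod ecolors DAtom)))) (elist dnat)
     (\<lambda>ask p. token_walk.available (adjacent (fst p)) (fst (snd p)) (fst (snd (snd p)))
        (fst (snd (snd (snd p)))) (snd (snd (snd (snd p)))))"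
  unfolding token_walk.available_def by (rule polytime_intros)+

lemmas polytime_available [polytime_intros] =
  polytime_lift5[where g = "\<lambda>ask es. token_walk.available (adjacent es)", OF polytime_available0]

lemma polytime_walk_step0:
  "polytime UNIV (eprod eedges (eprod (elist DAtom) (eprod dnat (eprod estate dnat)))) estate
     (\<lambda>ask p. token_walk.walk_step (adjacent (fst p)) (fst (snd p)) (fst (snd (snd p)))
        (fst (snd (snd (snd p)))) (snd (snd (snd (snd p)))))"
  unfolding token_walk.walk_step_def by (rule polytime_intros)+

lemmas polytime_walk_step [polytime_intros] =
  polytime_lift5[where g = "\<lambda>ask es. token_walk.walk_step (adjacent es)", OF polytime_walk_step0]

context token_walk
begin

text \<open>A move prepends one entry; its list cell, pair, atom and unary color \<open>c\<close>
  have size \<open>4 + 2 * c\<close>.\<close>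

lemma dsize_walk_step: "dsize (estate (walk_step s a)) \<le> dsize (estate s) + (4 + 2 * D + 2 * a)"
proof (cases s)
  case (Pair l f)
  show ?thesis
  proof (cases l)
    case Nil
    then show ?thesis using Pair by (simp add: walk_step_def)
  next
    case (Cons x xs)
    show ?thesis
    proof (cases "available f x")
      case (Cons c cs)
      then have "c \<in> set (available f x)" by simp
      then have "c < D" by (simp add: available_def)
      then show ?thesis using Pair \<open>l = x # xs\<close> Cons by (simp add: walk_step_def dsize_dnat)
    next
      case Nil
      then show ?thesis
        using Pair \<open>l = x # xs\<close> dsize_pos[of "elist DAtom xs"]
        by (auto simp: walk_step_def dsize_dnat split: list.split)
    qed
  qed
qed

lemma dsize_walk:
  "\<forall>a \<in> set w. a \<le> D \<Longrightarrow>
     dsize (estate (foldl walk_step s w)) \<le> dsize (estate s) + length w * (4 + 4 * D)"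
proof (induction w arbitrary: s)
  case (Cons a w)
  have "dsize (estate (foldl walk_step (walk_step s a) w)) \<le>
      dsize (estate (walk_step s a)) + length w * (4 + 4 * D)"
    using Cons by simp
  moreover have "dsize (estate (walk_step s a)) \<le> dsize (estate s) + (4 + 4 * D)"
    using dsize_walk_step[of s a] Cons.prems by simp
  ultimately show ?case by simp
qed simp

text \<open>The increment does not depend on \<open>f\<close>, as required for an additive fold. The
  single summand 4 is due to the pair and the one-element token list of the initial state; a walk
  has \<open>3 + 2 * length V\<close> letters.\<close>

lemma dsize_insert_color:
  "dsize (ecolors (insert_color f x)) \<le> dsize (ecolors f) + (4 + (3 + 2 * length V) * (4 + 4 * D))"
proof (cases "filter (\<lambda>s. fst s = []) (map (\<lambda>w. foldl walk_step ([x], f) w) walks)")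
  case Nil
  then show ?thesis by (simp add: insert_color_def)
next
  case (Cons s ss)
  then have "s \<in> set (filter (\<lambda>s. fst s = []) (map (\<lambda>w. foldl walk_step ([x], f) w) walks))"
    by simp
  then obtain w where w: "w \<in> set walks" "s = foldl walk_step ([x], f) w" by auto
  have "length (concat (map (\<lambda>_. [b, d]) V)) = 2 * length V" for b d :: nat
    by (induction V) auto
  then have "length w = 3 + 2 * length V" "\<forall>a \<in> set w. a \<le> D"
    using w(1) by (auto simp: walks_def zigzag_def split: if_splits)
  then have "dsize (estate s) \<le> dsize (estate ([x], f)) + (3 + 2 * length V) * (4 + 4 * D)"
    using dsize_walk[of w "([x], f)"] w(2) by simp
  moreover have "dsize (ecolors (snd s)) \<le> dsize (estate s)" by (simp add: eprod_def)
  ultimately have "dsize (ecolors (snd s)) \<le> dsize (ecolors f) + (4 + (3 + 2 * length V) * (4 + 4 * D))"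
    by simp
  then show ?thesis using Cons by (simp add: insert_color_def)
qed

end

lemma polytime_walk0:
  "polytime UNIV (eprod eedges (eprod (elist DAtom) (eprod dnat (eprod estate (elist dnat))))) estate
     (\<lambda>ask p. foldl (token_walk.walk_step (adjacent (fst p)) (fst (snd p)) (fst (snd (snd p))))
        (fst (snd (snd (snd p)))) (snd (snd (snd (snd p)))))"
proof (rule polytime_foldl_additive[where q = "[:4, 2:]"], goal_cases)
  case (4 ask p a s)
  obtain es V D t w where p: "p = (es, V, D, t, w)" by (cases p) auto
  have "dsize (dnat a :: 'a data) \<le> dsize (elist dnat w :: 'a data)"
    using 4 p by (intro dsize_elist_member) simp
  then have "4 + 2 * D + 2 * a \<le> poly [:4, 2:] (dsize (eprod eedges (eprod (elist DAtom)
      (eprod dnat (eprod estate (elist dnat)))) p))"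
    by (simp add: p dsize_dnat)
  with token_walk.dsize_walk_step[of "adjacent es" V D s a] show ?case by (simp add: p)
qed (rule polytime_intros)+

lemmas polytime_walk [polytime_intros] =
  polytime_lift5[where g = "\<lambda>ask es V D. foldl (token_walk.walk_step (adjacent es) V D)", OF polytime_walk0]

lemma polytime_insert_color0:
  "polytime UNIV (eprod eedges (eprod (elist DAtom) (eprod dnat (eprod ecolors DAtom)))) ecolors
     (\<lambda>ask p. token_walk.insert_color (adjacent (fst p)) (fst (snd p)) (fst (snd (snd p)))
        (fst (snd (snd (snd p)))) (snd (snd (snd (snd p)))))"
  unfolding token_walk.insert_color_def token_walk.walks_def token_walk.zigzag_def append.simps
  by (rule polytime_intros)+

lemmas polytime_insert_color [polytime_intros] =
  polytime_lift5[where g = "\<lambda>ask es. token_walk.insert_color (adjacent es)", OF polytime_insert_color0]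

lemma polytime_coloring0:
  "polytime UNIV (eprod eedges (eprod (elist DAtom) dnat)) ecolors
     (\<lambda>ask p. foldl (token_walk.insert_color (adjacent (fst p)) (fst (snd p)) (snd (snd p))) [] (fst (snd p)))"
proof (rule polytime_foldl_additive[where q = "[:4:] + [:3, 2:] * [:4, 4:]"], goal_cases)
  case (4 ask p x f)
  obtain es V D where p: "p = (es, V, D)" by (cases p) auto
  let ?n = "dsize (eprod eedges (eprod (elist DAtom) dnat) p)"
  have "length V \<le> ?n" "D \<le> ?n"
    using length_le_dsize_elist[of V DAtom] by (simp_all add: p dsize_dnat)
  then have "(3 + 2 * length V) * (4 + 4 * D) \<le> (3 + 2 * ?n) * (4 + 4 * ?n)"
    by (intro mult_le_mono) auto
  moreover have "poly ([:4:] + [:3, 2:] * [:4, 4:]) ?n = 4 + (3 + 2 * ?n) * (4 + 4 * ?n)"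
    by (simp add: algebra_simps)
  ultimately show ?case
    using token_walk.dsize_insert_color[of "adjacent es" V D f x] unfolding p fst_conv snd_conv by linarith
qed (rule polytime_intros)+

lemmas polytime_coloring [polytime_intros] =
  polytime_lift3[where g = "\<lambda>ask es V D. foldl (token_walk.insert_color (adjacent es) V D) [] V", OF polytime_coloring0]

lemma polytime_color_classes0:
  "polytime UNIV (eprod eedges (eprod (elist DAtom) dnat)) (elist (elist DAtom))
     (\<lambda>ask p. token_walk.color_classes (adjacent (fst p)) (fst (snd p)) (snd (snd p)))"
  unfolding token_walk.color_classes_def by (rule polytime_intros)+

lemmas polytime_color_classes [polytime_intros] =
  polytime_lift3[where g = "\<lambda>ask es. token_walk.color_classes (adjacent es)", OF polytime_color_classes0]

section \<open>Conflict graphs from independence queries\<close>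

definition ask_indep :: "('a data \<Rightarrow> bool) \<Rightarrow> nat \<Rightarrow> 'a list \<Rightarrow> bool" where
  "ask_indep ask i X = ask (DPair (dnat i) (elist DAtom X))"

lemma polytime_ask_indep [polytime_intros]:
  assumes "polytime A E dnat i" and "polytime A E (elist DAtom) X"
  shows "polytime A E dbool (\<lambda>ask x. ask_indep ask (i ask x) (X ask x))"
  using polytime_ask[OF polytime_Pair[OF assms]] by (simp add: ask_indep_def)

lemma polytime_greedy_basis0:
  "polytime UNIV (eprod dnat (elist DAtom)) (elist DAtom)
     (\<lambda>ask p. greedy_basis (ask_indep ask (fst p)) (snd p))"
  unfolding greedy_basis_def
  by (rule polytime_foldl_additive[where q = "[:2:]"]) (rule polytime_intros | simp)+

lemmas polytime_greedy_basis [polytime_intros] =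
  polytime_lift2[where g = "\<lambda>ask i. greedy_basis (ask_indep ask i)", OF polytime_greedy_basis0]

lemma polytime_excess0:
  "polytime UNIV (eprod dnat (elist DAtom)) (elist DAtom)
     (\<lambda>ask p. excess (ask_indep ask (fst p)) (snd p))"
  unfolding excess_def by (rule polytime_intros)+

lemmas polytime_excess [polytime_intros] =
  polytime_lift2[where g = "\<lambda>ask i. excess (ask_indep ask i)", OF polytime_excess0]

lemma polytime_partner0:
  "polytime UNIV (eprod dnat (eprod (elist DAtom) DAtom)) DAtom
     (\<lambda>ask p. partner (ask_indep ask (fst p)) (fst (snd p)) (snd (snd p)))"
  unfolding partner_def by (rule polytime_intros)+

lemmas polytime_partner [polytime_intros] =
  polytime_lift3[where g = "\<lambda>ask i. partner (ask_indep ask i)", OF polytime_partner0]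

lemma polytime_block_edges0:
  "polytime UNIV (eprod dnat (elist DAtom)) eedges
     (\<lambda>ask p. block_edges (ask_indep ask (fst p)) (snd p))"
  unfolding block_edges_def by (rule polytime_intros)+

lemmas polytime_block_edges [polytime_intros] =
  polytime_lift2[where g = "\<lambda>ask i. block_edges (ask_indep ask i)", OF polytime_block_edges0]

definition conflict_edges ::
    "('a data \<Rightarrow> bool) \<Rightarrow> (nat \<times> 'a list list) list \<Rightarrow> ('a \<times> 'a) list" where
  "conflict_edges ask Xs =
     concat (map (\<lambda>p. concat (map (\<lambda>T. block_edges (ask_indep ask (fst p)) T) (snd p))) Xs)"

text \<open>The vertices are taken from the blocks of all matroids, so each element of the class is
  listed once or more for every matroid.\<close>

definition class_coloring ::
    "('a data \<Rightarrow> bool) \<Rightarrow> nat \<Rightarrow> (nat \<times> 'a list list) list \<Rightarrow> 'a list list" where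
  "class_coloring ask k Xs = token_walk.color_classes (adjacent (conflict_edges ask Xs))
     (concat (concat (map (\<lambda>p. snd p) Xs))) (k * (k - 1))"

lemma polytime_class_coloring0:
  "polytime UNIV (eprod dnat (elist (eprod dnat (elist (elist DAtom))))) (elist (elist DAtom))
     (\<lambda>ask p. class_coloring ask (fst p) (snd p))"
  unfolding class_coloring_def conflict_edges_def by (rule polytime_intros)+

lemmas polytime_class_coloring [polytime_intros] =
  polytime_lift2[where g = class_coloring, OF polytime_class_coloring0]

section \<open>The output size of the given decomposition program\<close>

primrec ddepth :: "'a data \<Rightarrow> nat" where
  "ddepth DNil = 0"
| "ddepth (DAtom a) = 0"
| "ddepth (DPair x y) = 1 + max (ddepth x) (ddepth y)"

primrec expr_depth :: "expr \<Rightarrow> nat" where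
  "expr_depth (Var x) = 0"
| "expr_depth ENil = 0"
| "expr_depth (EPair e f) = 1 + max (expr_depth e) (expr_depth f)"
| "expr_depth (Fst e) = expr_depth e"
| "expr_depth (Snd e) = expr_depth e"
| "expr_depth (EqAtom e f) = 1"

primrec com_depth :: "com \<Rightarrow> nat" where
  "com_depth (Assign x e) = expr_depth e"
| "com_depth (Seq c d) = max (com_depth c) (com_depth d)"
| "com_depth (If e c d) = max (com_depth c) (com_depth d)"
| "com_depth (While e c) = com_depth c"
| "com_depth (Query x e) = 1"
| "com_depth (Call x c e) = max (expr_depth e) (com_depth c)"

lemma ddepth_evalE: "(\<And>x. ddepth (s x) \<le> m) \<Longrightarrow> ddepth (evalE e s) \<le> m + expr_depth e"
proof (induction e)
  case (EqAtom e f)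
  then show ?case by (simp add: dbool_def)
qed (auto split: data.split simp: trans_le_add1)

text \<open>Unlike the size, the depth of values grows only linearly in the running time. This bounds the size
  of the decompositions that the given program returns, which are lists of lists.\<close>

lemma ddepth_exec:
  "exec ask c s t s' \<Longrightarrow> (\<And>x. ddepth (s x) \<le> m) \<Longrightarrow> ddepth (s' x) \<le> m + t * com_depth c"
proof (induction arbitrary: m x rule: exec.induct)
  case (Assign x' e s)
  then show ?case using ddepth_evalE[of s m e] by (simp add: trans_le_add1)
next
  case (Seq c s t s' d t' s'')
  let ?k = "max (com_depth c) (com_depth d)"
  have "ddepth (s'' x) \<le> (m + t * com_depth c) + t' * com_depth d"
    by (rule Seq.IH(2)) (rule Seq.IH(1)[OF Seq.prems])
  also have "\<dots> \<le> (m + t * ?k) + t' * ?k" by (intro add_mono mult_le_mono) auto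
  finally show ?case by (simp add: add_mult_distrib)
next
  case (IfTrue e s c t s' d)
  have "ddepth (s' x) \<le> m + t * com_depth c" by (rule IfTrue.IH[OF IfTrue.prems])
  also have "\<dots> \<le> m + (1 + t) * max (com_depth c) (com_depth d)" by (intro add_mono mult_le_mono) auto
  finally show ?case by simp
next
  case (IfFalse e s d t s' c)
  have "ddepth (s' x) \<le> m + t * com_depth d" by (rule IfFalse.IH[OF IfFalse.prems])
  also have "\<dots> \<le> m + (1 + t) * max (com_depth c) (com_depth d)" by (intro add_mono mult_le_mono) auto
  finally show ?case by simp
next
  case (WhileFalse e s c)
  then show ?case by (simp add: trans_le_add1)
next
  case (WhileTrue e s c t s' t' s'')
  have "ddepth (s'' x) \<le> (m + t * com_depth c) + t' * com_depth (While e c)"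
    by (rule WhileTrue.IH(2)) (rule WhileTrue.IH(1)[OF WhileTrue.prems])
  then show ?case by (simp add: algebra_simps)
next
  case (Query x' e s)
  show ?case using Query[of x] by (simp add: dbool_def)
next
  case (Call c e s t s' x')
  let ?k = "max (expr_depth e) (com_depth c)"
  have "ddepth (s' 0) \<le> (m + expr_depth e) + t * com_depth c"
  proof (rule Call.IH)
    show "ddepth (input_store (evalE e s) y) \<le> m + expr_depth e" for y
      using ddepth_evalE[of s m e] Call.prems by (simp add: input_store_def)
  qed
  also have "\<dots> \<le> (m + ?k) + t * ?k" by (intro add_mono mult_le_mono) auto
  finally show ?case using Call.prems[of x] by (simp add: trans_le_add1)
qed

lemma ddepth_le_dsize: "ddepth d \<le> dsize d"
  by (induction d) auto

lemma length_le_ddepth: "length xs \<le> ddepth (elist E xs)"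
  by (induction xs) auto

lemma ddepth_member: "x \<in> set xs \<Longrightarrow> ddepth (E x) \<le> ddepth (elist E xs)"
  by (induction xs) auto

text \<open>Lists are nested to the right, so depth bounds both the number of inner lists and the
  length of each. As the innermost entries are atoms, the size is at most quadratic in the
  depth.\<close>

lemma dsize_blocks_le:
  fixes Xs :: "'a list list"
  assumes "ddepth (elist (elist DAtom) Xs) \<le> m"
  shows "dsize (elist (elist DAtom) Xs) \<le> 1 + m * (2 + 2 * m)"
proof -
  have "dsize (elist DAtom X) \<le> 1 + 2 * m" if "X \<in> set Xs" for X
  proof -
    have "length X \<le> m"
      using length_le_ddepth[of X DAtom] ddepth_member[OF that, of "elist DAtom"] assms by linarith
    moreover have "dsize (elist DAtom X) \<le> 1 + length X * (1 + 1)"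
      by (rule dsize_elist_le) simp
    ultimately show ?thesis by simp
  qed
  then have "dsize (elist (elist DAtom) Xs) \<le> 1 + length Xs * (1 + (1 + 2 * m))"
    by (rule dsize_elist_le)
  also have "\<dots> \<le> 1 + m * (1 + (1 + 2 * m))"
    using length_le_ddepth[of Xs "elist DAtom"] assms by (intro add_mono mult_le_mono) auto
  finally show ?thesis by simp
qed

text \<open>A decomposition problem admits many outputs. Choosing the one that the program returns
  gives a function, to which the closure rules apply.\<close>

lemma polytime_of_program:
  fixes p :: "nat poly" and E :: "'x \<Rightarrow> 'a data"
  assumes "\<And>ask x. (ask, x) \<in> A \<Longrightarrow> \<exists>t s y. exec ask c (input_store (E x)) t s \<and>
      t \<le> poly p (dsize (E x)) \<and> s 0 = elist (elist DAtom) y \<and> Q ask x y"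
  obtains f where "polytime A E (elist (elist DAtom)) f"
    and "\<And>ask x. (ask, x) \<in> A \<Longrightarrow> Q ask x (f ask x)"
proof -
  have "\<forall>ask x. \<exists>y. (ask, x) \<in> A \<longrightarrow> (\<exists>t s. exec ask c (input_store (E x)) t s \<and>
      t \<le> poly p (dsize (E x)) \<and> s 0 = elist (elist DAtom) y \<and> Q ask x y)"
    using assms by blast
  then obtain f where f: "\<And>ask x. (ask, x) \<in> A \<Longrightarrow> \<exists>t s. exec ask c (input_store (E x)) t s \<and>
      t \<le> poly p (dsize (E x)) \<and> s 0 = elist (elist DAtom) (f ask x) \<and> Q ask x (f ask x)"
    by metis
  let ?m = "[:0, 1:] + p * [:com_depth c:]"
  have "polytime A E (elist (elist DAtom)) f"
  proof (rule polytimeI[where c = c and p = p and q = "[:1:] + ?m * ([:2:] + [:2:] * ?m)"])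
    fix ask x assume A: "(ask, x) \<in> A"
    obtain t s where *: "exec ask c (input_store (E x)) t s" "t \<le> poly p (dsize (E x))"
      "s 0 = elist (elist DAtom) (f ask x)" using f[OF A] by blast
    then show "\<exists>t s. exec ask c (input_store (E x)) t s \<and> t \<le> poly p (dsize (E x)) \<and>
        s 0 = elist (elist DAtom) (f ask x)" by blast
    have "ddepth (s 0) \<le> dsize (E x) + t * com_depth c"
      by (rule ddepth_exec[OF *(1)]) (simp add: input_store_def ddepth_le_dsize)
    also have "\<dots> \<le> dsize (E x) + poly p (dsize (E x)) * com_depth c"
      using *(2) by simp
    finally have "ddepth (elist (elist DAtom) (f ask x)) \<le> poly ?m (dsize (E x))"
      using *(3) by (simp add: mult.commute)
    from dsize_blocks_le[OF this]
    show "dsize (elist (elist DAtom) (f ask x)) \<le> poly ([:1:] + ?m * ([:2:] + [:2:] * ?m)) (dsize (E x))"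
      by simp
  qed
  with f that show thesis by blast
qed

section \<open>Encodings of instances as lists\<close>

lemma dlist_inject: "dlist xs = dlist ys \<longleftrightarrow> xs = ys"
proof (induction xs arbitrary: ys)
  case Nil
  then show ?case by (cases ys) auto
next
  case (Cons x xs)
  then show ?case by (cases ys) auto
qed

lemma dnat_inject [simp]: "dnat i = dnat j \<longleftrightarrow> i = j"
  by (simp add: dnat_def dlist_inject)

lemma elist_DAtom_inject [simp]: "elist DAtom X = elist DAtom Y \<longleftrightarrow> X = Y"
  by (simp add: elist_def dlist_inject inj_map_eq_map inj_def)

lemma elist_elist_inject [simp]: "elist (elist DAtom) Xs = elist (elist DAtom) Ys \<longleftrightarrow> Xs = Ys"
  by (simp add: elist_def[of "elist DAtom"] dlist_inject inj_map_eq_map inj_def)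

lemma encodes_set_iff: "encodes_set d Y \<longleftrightarrow> (\<exists>X. d = elist DAtom X \<and> Y = set X)"
  by (auto simp: encodes_set_def elist_def)

lemma encodes_sets_iff: "encodes_sets d Ys \<longleftrightarrow> (\<exists>Xs. d = elist (elist DAtom) Xs \<and> Ys = map set Xs)"
proof
  assume "encodes_sets d Ys"
  then obtain ds where d: "d = dlist ds" "list_all2 encodes_set ds Ys"
    by (auto simp: encodes_sets_def)
  from d(2) have "\<exists>Xs. ds = map (elist DAtom) Xs \<and> Ys = map set Xs"
  proof (induction rule: list_all2_induct)
    case (Cons e ds Y Ys)
    then obtain X Xs where "e = elist DAtom X" "set X = Y" "ds = map (elist DAtom) Xs" "Ys = map set Xs"
      by (auto simp: encodes_set_iff)
    then show ?case by (intro exI[of _ "X # Xs"]) simp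
  qed simp
  with d(1) show "\<exists>Xs. d = elist (elist DAtom) Xs \<and> Ys = map set Xs"
    by (auto simp: elist_def)
next
  assume "\<exists>Xs. d = elist (elist DAtom) Xs \<and> Ys = map set Xs"
  then obtain Xs where "d = dlist (map (elist DAtom) Xs)" "Ys = map set Xs"
    by (auto simp: elist_def)
  moreover have "list_all2 encodes_set (map (elist DAtom) Xs) (map set Xs)"
    by (simp add: list_all2_conv_all_nth encodes_set_iff)
  ultimately show "encodes_sets d Ys" unfolding encodes_sets_def by blast
qed

abbreviation einstance :: "nat \<times> 'a list \<times> 'a list list \<Rightarrow> 'a data" where
  "einstance \<equiv> eprod dnat (eprod (elist DAtom) (elist (elist DAtom)))"

lemma encodes_instance_iff:
  "encodes_instance d U Is R \<longleftrightarrow>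
     (\<exists>us rs. d = einstance (length Is, us, rs) \<and> set us = U \<and> map set rs = R)"
  unfolding encodes_instance_def encodes_sets_iff
  by (auto simp: encodes_set_iff)

lemma ask_indep_query:
  "i < length Is \<Longrightarrow> ask_indep (indep_query Is) i X \<longleftrightarrow> set X \<in> Is ! i"
  by (auto simp: ask_indep_def indep_query_def encodes_set_iff)

section \<open>Coloring a single class\<close>

lemma class_coloring:
  assumes k: "2 \<le> length Is"
    and matroids: "\<And>I. I \<in> set Is \<Longrightarrow> matroid U I \<and> loopless U I"
    and "S \<subseteq> U"
    and flexible: "\<And>i. i < length Is \<Longrightarrow> flexible_decomposition (length Is) (Is ! i) S (map set (Ts i))"
  defines "Q \<equiv> class_coloring (indep_query Is) (length Is) (map (\<lambda>i. (i, Ts i)) [0..<length Is])"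
  shows "length Q = length Is * (length Is - 1)" and "\<Union>(set (map set Q)) = S"
    and "\<And>X I. X \<in> set Q \<Longrightarrow> I \<in> set Is \<Longrightarrow> set X \<in> I"
proof -
  let ?k = "length Is"
  let ?Xs = "map (\<lambda>i. (i, Ts i)) [0..<?k]"
  let ?ind = "ask_indep (indep_query Is)"
  define A where "A i = adjacent (concat (map (block_edges (?ind i)) (Ts i)))" for i
  define G where "G = adjacent (conflict_edges (indep_query Is) ?Xs)"
  define V where "V = concat (concat (map (\<lambda>p. snd p) ?Xs))"
  have dec: "oracle_decomposition U (Is ! i) (?ind i) (Ts i) S ?k" if i: "i < ?k" for i
  proof -
    interpret matroid U "Is ! i" using matroids i by simp
    show ?thesis
      by unfold_locales (use matroids i ask_indep_query flexible \<open>S \<subseteq> U\<close> k in auto)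
  qed
  have G_iff: "G u v \<longleftrightarrow> (\<exists>i < ?k. A i u v)" for u v
    by (auto simp: G_def A_def conflict_edges_def adjacent_iff)
  have "set V = (\<Union>i < ?k. \<Union>(set ` set (Ts i)))" by (auto simp: V_def)
  also have "\<dots> = S" using oracle_decomposition.blocks_union[OF dec] k by fastforce
  finally have V: "set V = S" .
  have sym: "A i u v \<Longrightarrow> A i v u" for i u v unfolding A_def by (rule adjacent_sym)
  have in_V: "v \<in> set V" if "G u v" for u v
    using that oracle_decomposition.H_in_R[OF dec] unfolding G_iff A_def V by blast
  have degree: "card {v. A i u v} \<le> ?k - 1" if "i < ?k" for i u
    using oracle_decomposition.degree[OF dec[OF that]] by (simp add: A_def)
  have "card {v. G u v} \<le> ?k * (?k - 1)" for u
  proof -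
    have "{v. G u v} = (\<Union>i < ?k. {v. A i u v})" by (auto simp: G_iff)
    then have "card {v. G u v} \<le> (\<Sum>i < ?k. card {v. A i u v})"
      using card_UN_le[of "{..<?k}"] by simp
    also have "\<dots> \<le> (\<Sum>i < ?k. ?k - 1)" using degree by (intro sum_mono) auto
    finally show ?thesis by simp
  qed
  then interpret clique_like_graph G V "?k * (?k - 1)" ?k A
  proof unfold_locales
    show "A i u v" if "i < ?k" "A i u x" "A i x v" "u \<noteq> v" "card {w. A i u w} = ?k - 1"
      "card {w. A i v w} = ?k - 1" for i u x v
      using oracle_decomposition.trans[OF dec[OF that(1)]] that unfolding A_def by blast
    show "G u v \<Longrightarrow> G v u" for u v using sym by (auto simp: G_iff)
    show "\<not> G u u" for u by (simp add: G_def adjacent_def)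
  qed (use in_V G_iff sym degree k in auto)
  have Q: "Q = color_classes" by (simp add: Q_def class_coloring_def G_def V_def)
  show "length Q = ?k * (?k - 1)" unfolding Q by (rule color_classes_correct(1))
  show union: "\<Union>(set (map set Q)) = S" unfolding Q V[symmetric] by (rule color_classes_correct(2))
  show "set X \<in> I" if X: "X \<in> set Q" and "I \<in> set Is" for X I
  proof -
    obtain i where i: "i < ?k" "I = Is ! i" using \<open>I \<in> set Is\<close> by (auto simp: in_set_conv_nth)
    show ?thesis unfolding i(2)
    proof (rule oracle_decomposition.stable_indep[OF dec[OF i(1)]])
      show "set X \<subseteq> S" using X union by auto
      show "\<not> adjacent (concat (map (block_edges (?ind i)) (Ts i))) u v"
        if "u \<in> set X" "v \<in> set X" for u v
        using color_classes_correct(3)[OF _ that] X i(1) unfolding Q G_iff A_def by blast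
    qed
  qed
qed

section \<open>Assembling the colorings of all classes\<close>

theorem theorem4p6:
  fixes \<C> :: "('a set \<times> 'a set set list \<times> 'a set list) set"
  assumes "\<And>U Is R. (U, Is, R) \<in> \<C> \<Longrightarrow> length Is \<ge> 2"
    and "\<And>U Is R I. (U, Is, R) \<in> \<C> \<Longrightarrow> I \<in> set Is \<Longrightarrow> matroid U I \<and> loopless U I"
    and "\<And>U Is R. (U, Is, R) \<in> \<C> \<Longrightarrow> pseudocoloring (length Is) (length R) U Is R"
    and "polytime_solvable (decomposition_problem (\<lambda>k. k) \<C>)"
  shows "polytime_solvable (coloring_problem (\<lambda>k q. k * (k - 1) * q) \<C>)"
proof -
  define A where "A = {(indep_query Is, (length Is, us, rs)) |Is us rs. (set us, Is, map set rs) \<in> \<C>}"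
  define B where "B = {(ask, (x, (i, j))). (ask, x) \<in> A \<and> i < fst x \<and> j < length (snd (snd x))}"
  let ?P = "decomposition_problem (\<lambda>k. k) \<C>"
  let ?E = "eprod einstance (eprod dnat dnat)"
  have problem: "(indep_query Is, ?E ((length Is, us, rs), i, j),
      {out. \<exists>Ts. encodes_sets out Ts \<and> flexible_decomposition (length Is) (Is ! i) (map set rs ! j) Ts}) \<in> ?P"
    if "(set us, Is, map set rs) \<in> \<C>" "i < length Is" "j < length rs" for Is us rs i j
    unfolding decomposition_problem_def
    by (intro CollectI exI[of _ "set us"] exI[of _ Is] exI[of _ "map set rs"]
        exI[of _ "einstance (length Is, us, rs)"] exI[of _ i] exI[of _ j])
      (use that in \<open>auto simp: encodes_instance_iff\<close>)
  obtain c p where cp: "\<forall>(ask, d, good) \<in> ?P.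
      \<exists>t s. exec ask c (input_store d) t s \<and> t \<le> poly p (dsize d) \<and> s 0 \<in> good"
    using assms(4) unfolding polytime_solvable_def by (elim exE)
  have c: "\<exists>t s. exec ask c (input_store d) t s \<and> t \<le> poly p (dsize d) \<and> s 0 \<in> good"
    if "(ask, d, good) \<in> ?P" for ask d good
    using bspec[OF cp that] by simp
  \<comment> \<open>It is not shown that \<open>(ask, z)\<close> determines the matroids. As runs
    are deterministic, the one output is admissible for every instance that this black box and input
    represent.\<close>
  have "\<exists>t s y. exec ask c (input_store (?E z)) t s \<and> t \<le> poly p (dsize (?E z)) \<and>
      s 0 = elist (elist DAtom) y \<and> (\<forall>good. (ask, ?E z, good) \<in> ?P \<longrightarrow> elist (elist DAtom) y \<in> good)"
    if askz: "(ask, z) \<in> B" for ask z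
  proof -
    obtain Is us rs i j where z: "ask = indep_query Is" "z = ((length Is, us, rs), i, j)"
      "(set us, Is, map set rs) \<in> \<C>" "i < length Is" "j < length rs"
      using askz unfolding A_def B_def by auto
    obtain t s where s: "exec ask c (input_store (?E z)) t s" "t \<le> poly p (dsize (?E z))"
      "\<exists>Ts. encodes_sets (s 0) Ts"
      using c[OF problem[OF z(3-5)]] unfolding z(1,2) by blast
    then obtain y where y: "s 0 = elist (elist DAtom) y" by (auto simp: encodes_sets_iff)
    have "s 0 \<in> good" if "(ask, ?E z, good) \<in> ?P" for good
      using c[OF that] exec_deterministic[OF s(1)] by blast
    with s y show ?thesis by metis
  qed
  then obtain dec where dec: "polytime B ?E (elist (elist DAtom)) dec"
    and good: "\<And>ask z good. (ask, z) \<in> B \<Longrightarrow> (ask, ?E z, good) \<in> ?P \<Longrightarrow>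
      elist (elist DAtom) (dec ask z) \<in> good"
    using polytime_of_program[where A = B and E = ?E and c = c and p = p and
      Q = "\<lambda>ask z y. \<forall>good. (ask, ?E z, good) \<in> ?P \<longrightarrow> elist (elist DAtom) y \<in> good"] by metis
  define out where "out ask x = concat (map (\<lambda>j. class_coloring ask (fst x)
      (map (\<lambda>i. (i, dec ask (x, (i, j)))) [0..<fst x])) [0..<length (snd (snd x))])" for ask x
  have "polytime A einstance (elist (elist DAtom)) out"
  proof -
    \<comment> \<open>The function \<open>dec\<close> is known to be polynomial on \<open>B\<close>
      only. This is the domain that two nested uses of \<open>polytime_map\<close> produce, the
      inner index \<open>i\<close> standing first.\<close>
    let ?B = "{(ask, (i, z)). (ask, z) \<in> {(ask, (j, x)). (ask, x) \<in> A \<and> j \<in> set [0..<length (snd (snd x))]} \<and>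
        i \<in> set [0..<fst (snd z)]}"
    have "polytime ?B (eprod dnat (eprod dnat einstance)) ?E (\<lambda>ask p. (snd (snd p), (fst p, fst (snd p))))"
      by (rule polytime_intros)+
    from polytime_comp[OF this dec]
    have "polytime ?B (eprod dnat (eprod dnat einstance)) (elist (elist DAtom))
        (\<lambda>ask p. dec ask (snd (snd p), (fst p, fst (snd p))))"
      by (auto simp: B_def)
    then show ?thesis unfolding out_def by - (rule polytime_intros | assumption)+
  qed
  then obtain c' and p' :: "nat poly" where c': "\<And>ask x. (ask, x) \<in> A \<Longrightarrow>
      \<exists>t s. exec ask c' (input_store (einstance x)) t s \<and> t \<le> poly p' (dsize (einstance x)) \<and>
        s 0 = elist (elist DAtom) (out ask x)"
    by (rule polytimeE) (erule that)
  have correct: "coloring (length Is * (length Is - 1) * length rs) (set us) Is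
      (map set (out (indep_query Is) (length Is, us, rs)))"
    if inst: "(set us, Is, map set rs) \<in> \<C>" for Is us rs
  proof -
    let ?x = "(length Is, us, rs)" and ?ask = "indep_query Is"
    define Q where "Q j = class_coloring ?ask (length Is)
        (map (\<lambda>i. (i, dec ?ask (?x, (i, j)))) [0..<length Is])" for j
    have out: "out ?ask ?x = concat (map Q [0..<length rs])" by (simp add: out_def Q_def[abs_def])
    have "\<Union>(set ` set rs) = set us"
      using assms(3)[OF inst] by (simp add: pseudocoloring_def partitions_def)
    moreover have "set rs = (\<lambda>j. rs ! j) ` {..<length rs}" by (auto simp: set_conv_nth)
    ultimately have union: "(\<Union>j < length rs. set (rs ! j)) = set us" by (simp add: image_image)
    have Q: "length (Q j) = length Is * (length Is - 1)" "\<Union>(set (map set (Q j))) = set (rs ! j)"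
      "\<And>X I. X \<in> set (Q j) \<Longrightarrow> I \<in> set Is \<Longrightarrow> set X \<in> I" if j: "j < length rs" for j
    proof -
      have "flexible_decomposition (length Is) (Is ! i) (set (rs ! j)) (map set (dec ?ask (?x, (i, j))))"
        if i: "i < length Is" for i
      proof -
        have "(?ask, (?x, (i, j))) \<in> B" using inst i j unfolding A_def B_def by auto
        from good[OF this problem[OF inst i j]] show ?thesis
          using j by (auto simp: encodes_sets_iff)
      qed
      note * = class_coloring[OF assms(1)[OF inst] assms(2)[OF inst] _ this]
      have "set (rs ! j) \<subseteq> set us" using union j by auto
      from *[OF _ this] show "length (Q j) = length Is * (length Is - 1)"
        "\<Union>(set (map set (Q j))) = set (rs ! j)"
        "\<And>X I. X \<in> set (Q j) \<Longrightarrow> I \<in> set Is \<Longrightarrow> set X \<in> I"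
        unfolding Q_def by blast+
    qed
    have "length (concat (map Q [0..<n])) = length Is * (length Is - 1) * n" if "n \<le> length rs" for n
      using that by (induction n) (simp_all add: Q(1))
    then have "length (out ?ask ?x) = length Is * (length Is - 1) * length rs" by (simp add: out)
    moreover have "\<Union>(set (map set (out ?ask ?x))) = (\<Union>j < length rs. \<Union>(set (map set (Q j))))"
      by (auto simp: out)
    then have "\<Union>(set (map set (out ?ask ?x))) = set us" using Q(2) union by simp
    ultimately show ?thesis using Q(3) by (auto simp: coloring_def out)
  qed
  show ?thesis
    unfolding polytime_solvable_def
  proof (intro exI[of _ c'] exI[of _ p'] ballI, clarify)
    fix ask d good assume "(ask, d, good) \<in> coloring_problem (\<lambda>k q. k * (k - 1) * q) \<C>"
    then obtain U Is R where *: "ask = indep_query Is" "(U, Is, R) \<in> \<C>" "encodes_instance d U Is R"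
      "good = {out. \<exists>Q. encodes_sets out Q \<and> coloring (length Is * (length Is - 1) * length R) U Is Q}"
      unfolding coloring_problem_def by auto
    then obtain us rs where d: "d = einstance (length Is, us, rs)" "set us = U" "map set rs = R"
      by (auto simp: encodes_instance_iff)
    have A: "(ask, (length Is, us, rs)) \<in> A" using * d unfolding A_def by auto
    have "elist (elist DAtom) (out ask (length Is, us, rs)) \<in> good"
      using correct[of us Is rs] * d by (auto simp: encodes_sets_iff)
    then show "\<exists>t s. exec ask c' (input_store d) t s \<and> t \<le> poly p' (dsize d) \<and> s 0 \<in> good"
      using c'[OF A, folded d(1)] by metis
  qed
qed

end
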